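(* Let $U\subset\mathbb{C}$ and $V\subset\mathbb{C}$ be discs, and let $\dot x = A(t,\varepsilon)x$ be a linear differential system of order $n\ge 1$, where $A(t,\varepsilon)$ is an $n\times n$ matrix whose entries are holomorphic in $(t,\varepsilon)\in U\times V$ (here $t$ is the time and $\varepsilon$ is a single parameter). Then the derived scalar differential equation for the variable $x_1$ is not singularly perturbed.
   Context: Derived equation. Write $\dot{}$ for $\partial/\partial t$. Put $a^{(0)}=(1,0,\dots,0)$ and, for $i\ge1$, define the row vectors $a^{(i)}=(a^{(i)}_1,\dots,a^{(i)}_n)$ of holomorphic functions on $U\times V$ by $a^{(i)}=\dot a^{(i-1)}+a^{(i-1)}A$. Thus for every solution $x$ of the system, $x_1^{(i)}=a^{(i)}x=\sum_j a^{(i)}_j x_j$, where $x_1^{(i)}$ is the $i$-th $t$-derivative. Let $k$, $1\le k\le n$, be the minimal integer such that $a^{(0)},\dots,a^{(k)}$ are linearly dependent over the field of meromorphic functions on $U\times V$. There is then a unique decomposition $a^{(k)}=A_{k-1}a^{(k-1)}+\dots+A_0a^{(0)}$ with $A_i$ meromorphic on $U\times V$. The derived equation for $x_1$ is $$x_1^{(k)}-A_{k-1}x_1^{(k-1)}-\dots-A_0x_1=0.$$ Singular perturbation. A meromorphic function $f(t,\varepsilon)=u(t,\varepsilon)/v(t,\varepsilon)$ ($u,v$ holomorphic) is called singularly perturbed at $\varepsilon_0$ if $v$ is divisible by a strictly higher power of $(\varepsilon-\varepsilon_0)$ than the one that divides $u$ (the zero function is not singularly perturbed). A scalar linear differential equation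 with meromorphic coefficients depending on one parameter $\varepsilon$, normalized so that its leading coefficient equals $1$, is called singularly perturbed if at least one of its coefficients is singularly perturbed at some point $\varepsilon_0$ of the parameter space. *)

theory Defs
  imports "HOL-Complex_Analysis.Complex_Analysis"
begin

text \<open>
  Points of \<open>\<complex>\<^sup>2\<close> are pairs \<open>(t, \<epsilon>)\<close>. Holomorphy in two variables is Frechet differentiability
  with a complex-linear derivative.
\<close>

definition holomorphic2_on :: "(complex \<times> complex \<Rightarrow> complex) \<Rightarrow> (complex \<times> complex) set \<Rightarrow> bool"
  where "holomorphic2_on f S \<longleftrightarrow>
    (\<forall>z\<in>S. \<exists>a b. (f has_derivative (\<lambda>h. a * fst h + b * snd h)) (at z within S))"

text \<open>
  A meromorphic function on a polydisc is represented by a total function that agrees with a quotient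
  \<open>u / v\<close> of holomorphic functions wherever \<open>v\<close> does not vanish; its values on the zero set
  of \<open>v\<close> are irrelevant. Equality of meromorphic functions is accordingly equality outside the
  zero set of some holomorphic function that is not identically zero.
\<close>

definition is_quotient_on ::
  "(complex \<times> complex) set \<Rightarrow> (complex \<times> complex \<Rightarrow> complex) \<Rightarrow>
   (complex \<times> complex \<Rightarrow> complex) \<Rightarrow> (complex \<times> complex \<Rightarrow> complex) \<Rightarrow> bool"
  where "is_quotient_on S f u v \<longleftrightarrow>
    holomorphic2_on u S \<and> holomorphic2_on v S \<and> (\<exists>z\<in>S. v z \<noteq> 0) \<and>
    (\<forall>z\<in>S. v z \<noteq> 0 \<longrightarrow> f z = u z / v z)"

definition meromorphic2_on :: "(complex \<times> complex \<Rightarrow> complex) \<Rightarrow> (complex \<times> complex) set \<Rightarrow> bool"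
  where "meromorphic2_on f S \<longleftrightarrow> (\<exists>u v. is_quotient_on S f u v)"

definition mero_eq_on ::
  "(complex \<times> complex) set \<Rightarrow> (complex \<times> complex \<Rightarrow> complex) \<Rightarrow> (complex \<times> complex \<Rightarrow> complex) \<Rightarrow> bool"
  where "mero_eq_on S f g \<longleftrightarrow>
    (\<exists>w. holomorphic2_on w S \<and> (\<exists>z\<in>S. w z \<noteq> 0) \<and> (\<forall>z\<in>S. w z \<noteq> 0 \<longrightarrow> f z = g z))"

text \<open>
  Matrices and row vectors of order \<open>n\<close> have entries indexed by \<open>{1..n}\<close>; values at other indices
  are never used.
\<close>

definition time_deriv :: "(complex \<times> complex \<Rightarrow> complex) \<Rightarrow> complex \<times> complex \<Rightarrow> complex"
  where "time_deriv f z = deriv (\<lambda>t. f (t, snd z)) (fst z)"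

primrec derived_row ::
  "nat \<Rightarrow> (nat \<Rightarrow> nat \<Rightarrow> complex \<times> complex \<Rightarrow> complex) \<Rightarrow> nat \<Rightarrow> nat \<Rightarrow> complex \<times> complex \<Rightarrow> complex"
  where
    "derived_row n A 0 = (\<lambda>j z. if j = 1 then 1 else 0)"
  | "derived_row n A (Suc i) =
       (\<lambda>j z. time_deriv (derived_row n A i j) z + (\<Sum>l=1..n. derived_row n A i l z * A l j z))"

text \<open>Linear dependence of the row vectors \<open>a 0, \<dots>, a k\<close> over the field of meromorphic functions.\<close>

definition mero_dependent ::
  "(complex \<times> complex) set \<Rightarrow> nat \<Rightarrow> (nat \<Rightarrow> nat \<Rightarrow> complex \<times> complex \<Rightarrow> complex) \<Rightarrow> nat \<Rightarrow> bool"
  where "mero_dependent S n a k \<longleftrightarrow>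
    (\<exists>c. (\<forall>i\<le>k. meromorphic2_on (c i) S) \<and>
         (\<exists>i\<le>k. \<not> mero_eq_on S (c i) (\<lambda>z. 0)) \<and>
         (\<forall>j\<in>{1..n}. mero_eq_on S (\<lambda>z. \<Sum>i\<le>k. c i z * a i j z) (\<lambda>z. 0)))"

text \<open>
  A scalar equation \<open>b k y\<^sup>(\<^sup>k\<^sup>) + \<dots> + b 1 y' + b 0 y = 0\<close> is given by its order \<open>k\<close> and its
  coefficients \<open>b\<close>.
\<close>

definition derived_equation ::
  "(complex \<times> complex) set \<Rightarrow> nat \<Rightarrow> (nat \<Rightarrow> nat \<Rightarrow> complex \<times> complex \<Rightarrow> complex) \<Rightarrow>
   nat \<Rightarrow> (nat \<Rightarrow> complex \<times> complex \<Rightarrow> complex) \<Rightarrow> bool"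
  where "derived_equation S n A k b \<longleftrightarrow>
    1 \<le> k \<and> k \<le> n \<and>
    mero_dependent S n (derived_row n A) k \<and>
    (\<forall>m<k. \<not> mero_dependent S n (derived_row n A) m) \<and>
    (\<exists>C. (\<forall>i<k. meromorphic2_on (C i) S) \<and>
         (\<forall>j\<in>{1..n}. mero_eq_on S (derived_row n A k j) (\<lambda>z. \<Sum>i<k. C i z * derived_row n A i j z)) \<and>
         b k = (\<lambda>z. 1) \<and> (\<forall>i<k. b i = (\<lambda>z. - C i z)))"

definition eps_power_dvd ::
  "(complex \<times> complex) set \<Rightarrow> complex \<Rightarrow> nat \<Rightarrow> (complex \<times> complex \<Rightarrow> complex) \<Rightarrow> bool"
  where "eps_power_dvd S \<epsilon>0 m f \<longleftrightarrow>
    (\<exists>g. holomorphic2_on g S \<and> (\<forall>z\<in>S. f z = (snd z - \<epsilon>0) ^ m * g z))"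

text \<open>
  Here \<open>p\<close> is the exact power dividing the numerator. It does not exist for a zero numerator, so the
  zero function is not singularly perturbed. On a product of discs, cancelling common factors
  shows that the choice of \<open>u\<close> and \<open>v\<close> does not matter.
\<close>

definition singularly_perturbed_at ::
  "(complex \<times> complex) set \<Rightarrow> (complex \<times> complex \<Rightarrow> complex) \<Rightarrow> complex \<Rightarrow> bool"
  where "singularly_perturbed_at S f \<epsilon>0 \<longleftrightarrow>
    (\<exists>u v p q. is_quotient_on S f u v \<and>
       eps_power_dvd S \<epsilon>0 p u \<and> \<not> eps_power_dvd S \<epsilon>0 (Suc p) u \<and>
       p < q \<and> eps_power_dvd S \<epsilon>0 q v)"

definition singularly_perturbed_equation ::
  "complex set \<Rightarrow> complex set \<Rightarrow> nat \<Rightarrow> (nat \<Rightarrow> complex \<times> complex \<Rightarrow> complex) \<Rightarrow> bool"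
  where "singularly_perturbed_equation U V k b \<longleftrightarrow>
    (\<exists>i\<le>k. \<exists>\<epsilon>0\<in>V. singularly_perturbed_at (U \<times> V) (b i) \<epsilon>0)"

end

theory Submission
  imports Defs
begin

text \<open>
  Fix a value \<open>e0\<close> of the parameter and put \<open>\<pi> = e - e0\<close>. The functions holomorphic on \<open>U \<times> V\<close> form
  an integral domain in which \<open>\<pi>\<close> is prime, since being divisible by \<open>\<pi>\<close> means vanishing on the fibre
  \<open>e = e0\<close>. The derivative in time maps this ring to itself and kills \<open>\<pi>\<close>. The rest is algebra.

  Clear denominators in the derived equation and divide by the largest common power of \<open>\<pi>\<close>. This gives
  a relation between the derived rows \<open>a 0, \<dots>, a k\<close> with holomorphic coefficients \<open>p 0, \<dots>, p k\<close>, not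
  all divisible by \<open>\<pi>\<close>. The coefficients of the derived equation are the quotients \<open>p i / p k\<close>, so it
  is enough to show that \<open>\<pi>\<close> does not divide \<open>p k\<close>
  (\<open>primitive_relation_keeps_order\<close>).

  Suppose it does, and let \<open>d < k\<close> be the largest index such that \<open>\<pi>\<close> does not divide \<open>p d\<close>. Localize at
  \<open>\<pi>\<close>, so that \<open>p d\<close> becomes invertible. Then \<open>a d\<close> is a combination of \<open>a 0, \<dots>, a (d - 1)\<close> plus \<open>\<pi>\<close>
  times later rows. Differentiating, and substituting repeatedly, one finds that for every \<open>m\<close> all
  derived rows are combinations of \<open>a 0, \<dots>, a (d - 1)\<close> up to multiples of \<open>\<pi> ^ m\<close>
  (\<open>rows_in_span_mod_eps_power\<close>). It is essential here that the rows are holomorphic in \<open>e\<close>: what is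
  multiplied by \<open>\<pi> ^ m\<close> has no power of \<open>\<pi>\<close> in its denominator.

  On the other hand, \<open>a 0, \<dots>, a d\<close> are linearly independent by the minimality of \<open>k\<close>. So there is a
  holomorphic linear form that kills \<open>a 0, \<dots>, a (d - 1)\<close> but not \<open>a d\<close>
  (\<open>relation_or_separating_functional\<close>). Its value at \<open>a d\<close> is divisible by every power of \<open>\<pi>\<close>, hence
  zero, a contradiction.

  The analytic input is Osgood's lemma (\<open>separately_imp_holomorphic2_on\<close>). It shows that the ring is
  closed under the time derivative and under division by \<open>\<pi>\<close> of functions that vanish on the fibre.
\<close>

section \<open>Holomorphic functions of two variables\<close>

text \<open>
  By the Cauchy integral formula the derivative is, locally in \<open>t\<close>, an integral of \<open>f\<close> over a
  fixed circle, and such an integral depends continuously on all parameters.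
\<close>

lemma continuous_on_complex_deriv_param:
  fixes f :: "complex \<times> 'a::metric_space \<Rightarrow> complex"
  assumes "open U" and cont: "continuous_on (U \<times> E) f"
    and hol: "\<And>e. e \<in> E \<Longrightarrow> (\<lambda>t. f (t, e)) holomorphic_on U"
  shows "continuous_on (U \<times> E) (\<lambda>z. deriv (\<lambda>t. f (t, snd z)) (fst z))"
proof -
  have "continuous (at z within U \<times> E) (\<lambda>z. deriv (\<lambda>t. f (t, snd z)) (fst z))"
    if z: "z \<in> U \<times> E" for z
  proof -
    have "fst z \<in> U" using z by auto
    then obtain \<rho> where \<rho>: "\<rho> > 0" "cball (fst z) \<rho> \<subseteq> U"
      using open_contains_cball_eq[OF \<open>open U\<close>] by blast
    let ?B = "ball (fst z) \<rho>"
    define \<zeta> where "\<zeta> = circlepath (fst z) \<rho>"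
    have \<zeta>: "\<zeta> s \<in> sphere (fst z) \<rho>" if "s \<in> {0..1}" for s
      using \<rho>(1) that path_image_circlepath[of "fst z" \<rho>] unfolding \<zeta>_def path_image_def
      by auto
    have vd: "vector_derivative \<zeta> (at s) = 2 * pi * \<i> * \<rho> * exp (2 * of_real pi * \<i> * s)" for s
      unfolding \<zeta>_def by (rule vector_derivative_circlepath)
    have c\<zeta>: "continuous_on T \<zeta>" for T
      unfolding \<zeta>_def circlepath_def part_circlepath_def linepath_def by (intro continuous_intros)
    have int: "continuous_on (?B \<times> E)
      (\<lambda>w. integral (cbox 0 1) (\<lambda>s. f (\<zeta> s, snd w) / (\<zeta> s - fst w)^2 * vector_derivative \<zeta> (at s)))"
    proof (rule integral_continuous_on_param)
      have "\<zeta> s \<in> U" if "s \<in> {0..1}" for s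
        using \<zeta>[OF that] \<rho>(2) by auto
      then have 1: "continuous_on ((?B \<times> E) \<times> cbox (0::real) 1) (\<lambda>p. f (\<zeta> (snd p), snd (fst p)))"
        by (intro continuous_on_compose2[OF cont] continuous_intros continuous_on_compose2[OF c\<zeta>]) auto
      have 2: "continuous_on ((?B \<times> E) \<times> cbox (0::real) 1) (\<lambda>p. \<zeta> (snd p))"
        by (rule continuous_on_compose2[OF c\<zeta>]) (auto intro!: continuous_intros)
      have 3: "\<zeta> (snd p) - fst (fst p) \<noteq> 0" if "p \<in> (?B \<times> E) \<times> cbox (0::real) 1" for p
        using \<zeta>[of "snd p"] that by auto
      show "continuous_on ((?B \<times> E) \<times> cbox (0::real) 1)
        (\<lambda>(w, s). f (\<zeta> s, snd w) / (\<zeta> s - fst w)^2 * vector_derivative \<zeta> (at s))"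
        unfolding vd split_beta
        by (intro continuous_intros 1 2) (use 3 in auto)
    qed
    have formula: "deriv (\<lambda>t. f (t, snd w)) (fst w) = 1 / (2 * of_real pi * \<i>) *
      integral (cbox 0 1) (\<lambda>s. f (\<zeta> s, snd w) / (\<zeta> s - fst w)^2 * vector_derivative \<zeta> (at s))"
      if "w \<in> ?B \<times> E" for w
    proof -
      have h: "(\<lambda>t. f (t, snd w)) holomorphic_on cball (fst z) \<rho>"
        using hol[of "snd w"] that \<rho>(2) holomorphic_on_subset by auto
      show ?thesis
        using DERIV_imp_deriv[OF Cauchy_derivative_integral_circlepath(2)[of "fst z" \<rho> "\<lambda>t. f (t, snd w)" "fst w"]]
          h that holomorphic_on_imp_continuous_on[OF h] holomorphic_on_subset[OF h ball_subset_cball]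
        by (auto simp: contour_integral_integral \<zeta>_def)
    qed
    have "continuous_on (?B \<times> E) (\<lambda>z. deriv (\<lambda>t. f (t, snd z)) (fst z))"
      by (rule continuous_on_eq[OF continuous_on_mult_left[OF int] formula[symmetric]])
    then have "continuous (at z within ?B \<times> E) (\<lambda>z. deriv (\<lambda>t. f (t, snd z)) (fst z))"
      using z \<rho>(1) unfolding continuous_on_eq_continuous_within by (cases z) auto
    moreover have "at z within ?B \<times> E = at z within U \<times> E"
      by (rule at_within_nhd[of _ "?B \<times> UNIV"])
         (use z \<rho> in \<open>auto simp: mem_Times_iff open_Times\<close>)
    ultimately show ?thesis by simp
  qed
  then show ?thesis by (simp add: continuous_on_eq_continuous_within)
qed

lemma continuous_on_complex_deriv_param_snd:
  fixes f :: "'a::metric_space \<times> complex \<Rightarrow> complex"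
  assumes "open V" and cont: "continuous_on (E \<times> V) f"
    and hol: "\<And>t. t \<in> E \<Longrightarrow> (\<lambda>e. f (t, e)) holomorphic_on V"
  shows "continuous_on (E \<times> V) (\<lambda>z. deriv (\<lambda>e. f (fst z, e)) (snd z))"
proof -
  have "continuous_on (V \<times> E) (\<lambda>z. f (snd z, fst z))"
    by (rule continuous_on_compose2[OF cont]) (auto intro!: continuous_intros)
  from continuous_on_complex_deriv_param[OF \<open>open V\<close> this] hol
  have "continuous_on (V \<times> E) (\<lambda>z. deriv (\<lambda>e. f (snd z, e)) (fst z))" by simp
  moreover have "continuous_on (E \<times> V) (\<lambda>z. (snd z, fst z))" by (intro continuous_intros)
  moreover have "(\<lambda>z. (snd z, fst z)) ` (E \<times> V) \<subseteq> V \<times> E" by auto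
  ultimately show ?thesis
    using continuous_on_compose2[of "V \<times> E" "\<lambda>z. deriv (\<lambda>e. f (snd z, e)) (fst z)"
        "E \<times> V" "\<lambda>z. (snd z, fst z)"] by simp
qed

text \<open>
  Again the Cauchy formula: the derivative in \<open>t\<close> is an integral over a circle of functions that
  are holomorphic in \<open>e\<close>, and one may differentiate under the integral sign because the
  partial derivative in \<open>e\<close> is continuous by the preceding lemma.
\<close>

lemma holomorphic_on_deriv_param:
  fixes f :: "complex \<times> complex \<Rightarrow> complex"
  assumes "open U" "open V" "convex V" and cont: "continuous_on (U \<times> V) f"
    and holt: "\<And>e. e \<in> V \<Longrightarrow> (\<lambda>t. f (t, e)) holomorphic_on U"
    and hole: "\<And>t. t \<in> U \<Longrightarrow> (\<lambda>e. f (t, e)) holomorphic_on V"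
    and t: "t \<in> U"
  shows "(\<lambda>e. deriv (\<lambda>t. f (t, e)) t) holomorphic_on V"
proof -
  obtain \<rho> where \<rho>: "\<rho> > 0" "cball t \<rho> \<subseteq> U"
    using open_contains_cball_eq[OF \<open>open U\<close>] t by blast
  define \<zeta> where "\<zeta> = circlepath t \<rho>"
  have \<zeta>: "\<zeta> s \<in> sphere t \<rho>" if "s \<in> {0..1}" for s
    using \<rho>(1) that path_image_circlepath[of t \<rho>] unfolding \<zeta>_def path_image_def
    by auto
  have \<zeta>U: "\<zeta> s \<in> U" "\<zeta> s \<noteq> t" if "s \<in> {0..1}" for s
    using \<zeta>[OF that] \<rho> by (auto simp: subset_iff)
  have vd: "vector_derivative \<zeta> (at s) = 2 * pi * \<i> * \<rho> * exp (2 * of_real pi * \<i> * s)" for s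
    unfolding \<zeta>_def by (rule vector_derivative_circlepath)
  have c\<zeta>: "continuous_on T \<zeta>" for T
    unfolding \<zeta>_def circlepath_def part_circlepath_def linepath_def by (intro continuous_intros)
  have int: "(\<lambda>e. integral (cbox 0 1) (\<lambda>s. f (\<zeta> s, e) / (\<zeta> s - t)^2 * vector_derivative \<zeta> (at s)))
      holomorphic_on V"
  proof (rule leibniz_rule_holomorphic[where
        fx = "\<lambda>e s. deriv (\<lambda>e. f (\<zeta> s, e)) e / (\<zeta> s - t)^2 * vector_derivative \<zeta> (at s)"])
    fix e s assume "e \<in> V" "s \<in> cbox (0::real) 1"
    then have "((\<lambda>e. f (\<zeta> s, e)) has_field_derivative deriv (\<lambda>e. f (\<zeta> s, e)) e) (at e)"
      using hole[OF \<zeta>U(1)[of s]] \<open>open V\<close> holomorphic_derivI by auto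
    then show "((\<lambda>e. f (\<zeta> s, e) / (\<zeta> s - t)^2 * vector_derivative \<zeta> (at s)) has_field_derivative
        deriv (\<lambda>e. f (\<zeta> s, e)) e / (\<zeta> s - t)^2 * vector_derivative \<zeta> (at s)) (at e within V)"
      by (intro DERIV_cmult_right DERIV_cdivide) (rule has_field_derivative_at_within)
  next
    fix e assume "e \<in> V"
    have 1: "continuous_on (cbox (0::real) 1) (\<lambda>s. f (\<zeta> s, e))"
      by (rule continuous_on_compose2[OF cont]) (use \<zeta>U \<open>e \<in> V\<close> in \<open>auto intro!: continuous_intros c\<zeta>\<close>)
    show "(\<lambda>s. f (\<zeta> s, e) / (\<zeta> s - t)^2 * vector_derivative \<zeta> (at s)) integrable_on cbox 0 1"
      unfolding vd by (intro integrable_continuous continuous_intros 1 c\<zeta>) (use \<zeta>U in auto)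
  next
    have 1: "continuous_on (V \<times> cbox (0::real) 1) (\<lambda>p. deriv (\<lambda>e. f (\<zeta> (snd p), e)) (fst p))"
    proof -
      have "continuous_on (V \<times> cbox (0::real) 1) (\<lambda>p. (\<zeta> (snd p), fst p))"
        by (intro continuous_intros continuous_on_compose2[OF c\<zeta>]) auto
      moreover have "(\<lambda>p. (\<zeta> (snd p), fst p)) ` (V \<times> cbox (0::real) 1) \<subseteq> U \<times> V"
        using \<zeta>U by auto
      ultimately show ?thesis
        using continuous_on_compose2[OF continuous_on_complex_deriv_param_snd[OF \<open>open V\<close> cont hole],
            of "V \<times> cbox (0::real) 1" "\<lambda>p. (\<zeta> (snd p), fst p)"] by simp
    qed
    have 2: "continuous_on (V \<times> cbox (0::real) 1) (\<lambda>p. \<zeta> (snd p))"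
      by (rule continuous_on_compose2[OF c\<zeta>]) (auto intro!: continuous_intros)
    show "continuous_on (V \<times> cbox (0::real) 1)
        (\<lambda>(e, s). deriv (\<lambda>e. f (\<zeta> s, e)) e / (\<zeta> s - t)^2 * vector_derivative \<zeta> (at s))"
      unfolding vd split_beta by (intro continuous_intros 1 2) (use \<zeta>U in auto)
  qed fact
  have formula: "deriv (\<lambda>t. f (t, e)) t = 1 / (2 * of_real pi * \<i>) *
      integral (cbox 0 1) (\<lambda>s. f (\<zeta> s, e) / (\<zeta> s - t)^2 * vector_derivative \<zeta> (at s))"
    if "e \<in> V" for e
  proof -
    have h: "(\<lambda>t. f (t, e)) holomorphic_on cball t \<rho>"
      using holt[of e] that \<rho>(2) holomorphic_on_subset by auto
    show ?thesis
      using DERIV_imp_deriv[OF Cauchy_derivative_integral_circlepath(2)[of t \<rho> "\<lambda>t. f (t, e)" t]]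
        h \<rho>(1) holomorphic_on_imp_continuous_on[OF h] holomorphic_on_subset[OF h ball_subset_cball]
      by (auto simp: contour_integral_integral \<zeta>_def)
  qed
  show ?thesis
    by (rule holomorphic_transform[OF holomorphic_on_mult[OF holomorphic_on_const int] formula[symmetric]])
qed

lemma holomorphic2_on_imp_separately:
  assumes "holomorphic2_on f (U \<times> V)"
  shows "continuous_on (U \<times> V) f"
    and "e \<in> V \<Longrightarrow> (\<lambda>t. f (t, e)) holomorphic_on U"
    and "t \<in> U \<Longrightarrow> (\<lambda>e. f (t, e)) holomorphic_on V"
proof -
  show "continuous_on (U \<times> V) f"
    using assms unfolding holomorphic2_on_def
    by (meson continuous_on_eq_continuous_within has_derivative_continuous)
  show "(\<lambda>t. f (t, e)) holomorphic_on U" if e: "e \<in> V"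
    unfolding holomorphic_on_def field_differentiable_def
  proof
    fix t assume "t \<in> U"
    then obtain a b where "(f has_derivative (\<lambda>h. a * fst h + b * snd h)) (at (t, e) within U \<times> V)"
      using assms e unfolding holomorphic2_on_def by blast
    then have "(f has_derivative (\<lambda>h. a * fst h + b * snd h)) (at (t, e) within (\<lambda>t. (t, e)) ` U)"
      by (rule has_derivative_subset) (use e in auto)
    moreover have "((\<lambda>t. (t, e)) has_derivative (\<lambda>h. (h, 0::complex))) (at t within U)"
      by (intro has_derivative_Pair has_derivative_ident has_derivative_const)
    ultimately have "((\<lambda>t. f (t, e)) has_derivative (\<lambda>h. a * fst (h, 0::complex) + b * snd (h, 0::complex))) (at t within U)"
      using has_derivative_in_compose by blast
    then show "\<exists>d. ((\<lambda>t. f (t, e)) has_field_derivative d) (at t within U)"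
      by (auto simp: has_field_derivative_def)
  qed
  show "(\<lambda>e. f (t, e)) holomorphic_on V" if t: "t \<in> U"
    unfolding holomorphic_on_def field_differentiable_def
  proof
    fix e assume "e \<in> V"
    then obtain a b where "(f has_derivative (\<lambda>h. a * fst h + b * snd h)) (at (t, e) within U \<times> V)"
      using assms t unfolding holomorphic2_on_def by blast
    then have "(f has_derivative (\<lambda>h. a * fst h + b * snd h)) (at (t, e) within (\<lambda>e. (t, e)) ` V)"
      by (rule has_derivative_subset) (use t in auto)
    moreover have "((\<lambda>e. (t, e)) has_derivative (\<lambda>h. (0::complex, h))) (at e within V)"
      by (intro has_derivative_Pair has_derivative_ident has_derivative_const)
    ultimately have "((\<lambda>e. f (t, e)) has_derivative (\<lambda>h. a * fst (0::complex, h) + b * snd (0::complex, h))) (at e within V)"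
      using has_derivative_in_compose by blast
    then show "\<exists>d. ((\<lambda>e. f (t, e)) has_field_derivative d) (at e within V)"
      by (auto simp: has_field_derivative_def)
  qed
qed

text \<open>
  Osgood's lemma. It turns every question about joint differentiability into two one-variable
  questions and one about continuity; the total derivative exists because the partial derivative
  in \<open>e\<close> is continuous.
\<close>

lemma separately_imp_holomorphic2_on:
  assumes "open U" "open V" "convex V" and cont: "continuous_on (U \<times> V) f"
    and holt: "\<And>e. e \<in> V \<Longrightarrow> (\<lambda>t. f (t, e)) holomorphic_on U"
    and hole: "\<And>t. t \<in> U \<Longrightarrow> (\<lambda>e. f (t, e)) holomorphic_on V"
  shows "holomorphic2_on f (U \<times> V)"
  unfolding holomorphic2_on_def
proof
  fix z assume "z \<in> U \<times> V"
  then obtain t e where z: "z = (t, e)" "t \<in> U" "e \<in> V" by auto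
  have "continuous_on (U \<times> V) (\<lambda>(t, e). deriv (\<lambda>e. f (t, e)) e)"
    using continuous_on_complex_deriv_param_snd[OF \<open>open V\<close> cont hole] by (simp add: split_beta)
  then have "continuous (at (t, e) within U \<times> V) (\<lambda>(t, e). blinfun_mult_right (deriv (\<lambda>e. f (t, e)) e))"
    using z unfolding split_beta
    by (intro bounded_linear.continuous[OF bounded_linear_blinfun_mult_right])
       (auto simp: continuous_on_eq_continuous_within)
  then have "((\<lambda>(t, e). f (t, e)) has_derivative
     (\<lambda>(ht, he). deriv (\<lambda>t. f (t, e)) t * ht + blinfun_mult_right (deriv (\<lambda>e. f (t, e)) e) he))
     (at (t, e) within U \<times> V)"
    using z assms
    by (intro has_derivative_partialsI)
       (auto simp: has_field_derivative_def[symmetric] intro!: holomorphic_derivI)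
  then have "(f has_derivative
     (\<lambda>h. deriv (\<lambda>t. f (t, e)) t * fst h + deriv (\<lambda>e. f (t, e)) e * snd h)) (at z within U \<times> V)"
    by (simp add: z case_prod_unfold)
  then show "\<exists>a b. (f has_derivative (\<lambda>h. a * fst h + b * snd h)) (at z within U \<times> V)" by blast
qed

lemma holomorphic2_on_time_deriv:
  assumes "open U" "open V" "convex V" and f: "holomorphic2_on f (U \<times> V)"
  shows "holomorphic2_on (time_deriv f) (U \<times> V)"
  using assms holomorphic2_on_imp_separately[OF f]
    continuous_on_complex_deriv_param[of U V f] holomorphic_on_deriv_param[of U V f]
  by (intro separately_imp_holomorphic2_on)
     (auto simp: time_deriv_def[abs_def] intro!: holomorphic_deriv)

lemma holomorphic2_on_swap:
  assumes "open U" "open V" "convex U" and f: "holomorphic2_on f (U \<times> V)"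
  shows "holomorphic2_on (\<lambda>z. f (snd z, fst z)) (V \<times> U)"
  using assms holomorphic2_on_imp_separately[OF f]
  by (intro separately_imp_holomorphic2_on)
     (auto intro!: continuous_intros continuous_on_compose2[of "U \<times> V" f])

lemma holomorphic2_on_eps_deriv:
  assumes "open U" "open V" "convex U" "convex V" and f: "holomorphic2_on f (U \<times> V)"
  shows "holomorphic2_on (\<lambda>z. deriv (\<lambda>e. f (fst z, e)) (snd z)) (U \<times> V)"
  using holomorphic2_on_swap[OF _ _ _ holomorphic2_on_time_deriv[OF _ _ _ holomorphic2_on_swap[OF _ _ _ f]]] assms
  by (simp add: time_deriv_def[abs_def])

lemma convex_scaling_mem:
  fixes V :: "complex set"
  assumes "convex V" "e0 \<in> V" "e \<in> V" "s \<in> {0..1::real}"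
  shows "e0 + of_real s * (e - e0) \<in> V"
  using convexD_alt[OF assms(1-3), of s] assms(4) by (simp add: scaleR_conv_of_real algebra_simps)

text \<open>
  This average over the segment from \<open>e0\<close> to \<open>e\<close> is Hadamard's formula for a difference quotient.
  Written as an integral it has no exceptional point at \<open>e = e0\<close>, so that holomorphy there needs
  no separate argument.
\<close>

lemma holomorphic2_on_segment_average:
  assumes "open U" "open V" "convex U" "convex V" "e0 \<in> V" and F: "holomorphic2_on F (U \<times> V)"
  shows "holomorphic2_on (\<lambda>z. integral (cbox 0 1) (\<lambda>s. F (fst z, e0 + of_real s * (snd z - e0)))) (U \<times> V)"
proof (rule separately_imp_holomorphic2_on)
  note mem = convex_scaling_mem[OF \<open>convex V\<close> \<open>e0 \<in> V\<close>]
  have comp: "continuous_on T (\<lambda>x. G (a x, b x))"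
    if "holomorphic2_on G (U \<times> V)" "continuous_on T a" "continuous_on T b" "\<And>x. x \<in> T \<Longrightarrow> a x \<in> U"
      "\<And>x. x \<in> T \<Longrightarrow> b x \<in> V" for T :: "'x::topological_space set" and a b G
    by (rule continuous_on_compose2[OF holomorphic2_on_imp_separately(1)[OF that(1)]])
       (use that in \<open>auto intro!: continuous_intros\<close>)
  show "continuous_on (U \<times> V) (\<lambda>z. integral (cbox 0 1) (\<lambda>s. F (fst z, e0 + of_real s * (snd z - e0))))"
    by (rule integral_continuous_on_param, unfold split_beta)
       (intro comp[OF F] continuous_intros; use mem in auto)
  show "(\<lambda>t. integral (cbox 0 1) (\<lambda>s. F (fst (t, e), e0 + of_real s * (snd (t, e) - e0)))) holomorphic_on U"
    if "e \<in> V" for e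
  proof (rule leibniz_rule_holomorphic)
    show "((\<lambda>t. F (fst (t, e), e0 + of_real s * (snd (t, e) - e0))) has_field_derivative
        time_deriv F (t, e0 + of_real s * (e - e0))) (at t within U)" if "t \<in> U" "s \<in> cbox 0 1" for t s
      using that mem[OF \<open>e \<in> V\<close>, of s] holomorphic2_on_imp_separately(2)[OF F] \<open>open U\<close>
      by (auto simp: time_deriv_def intro!: holomorphic_derivI)
    show "(\<lambda>s. F (fst (t, e), e0 + of_real s * (snd (t, e) - e0))) integrable_on cbox 0 1" if "t \<in> U" for t
      by (intro integrable_continuous comp[OF F] continuous_intros) (use mem[OF \<open>e \<in> V\<close>] that in auto)
    show "continuous_on (U \<times> cbox 0 1) (\<lambda>(t, s). time_deriv F (t, e0 + of_real s * (e - e0)))"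
      unfolding split_beta
      by (intro comp[OF holomorphic2_on_time_deriv[OF assms(1,2,4) F]] continuous_intros)
         (use mem[OF \<open>e \<in> V\<close>] in auto)
  qed fact
  show "(\<lambda>e. integral (cbox 0 1) (\<lambda>s. F (fst (t, e), e0 + of_real s * (snd (t, e) - e0)))) holomorphic_on V"
    if "t \<in> U" for t
  proof (rule leibniz_rule_holomorphic)
    show "((\<lambda>e. F (fst (t, e), e0 + of_real s * (snd (t, e) - e0))) has_field_derivative
        deriv (\<lambda>e. F (t, e)) (e0 + of_real s * (e - e0)) * of_real s) (at e within V)"
      if "e \<in> V" "s \<in> cbox 0 1" for e s
    proof -
      have "((\<lambda>e. F (t, e)) has_field_derivative deriv (\<lambda>e. F (t, e)) (e0 + of_real s * (e - e0)))
          (at (e0 + of_real s * (e - e0)))"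
        using mem[OF that(1), of s] that holomorphic2_on_imp_separately(3)[OF F \<open>t \<in> U\<close>] \<open>open V\<close>
        by (auto intro!: holomorphic_derivI)
      moreover have "((\<lambda>e. e0 + of_real s * (e - e0)) has_field_derivative of_real s) (at e within V)"
        by (auto intro!: derivative_eq_intros)
      ultimately show ?thesis
        using DERIV_chain2[where f = "\<lambda>e. F (t, e)" and g = "\<lambda>e. e0 + of_real s * (e - e0)"] by simp
    qed
    show "(\<lambda>s. F (fst (t, e), e0 + of_real s * (snd (t, e) - e0))) integrable_on cbox 0 1" if "e \<in> V" for e
      by (intro integrable_continuous comp[OF F] continuous_intros) (use mem[OF that] \<open>t \<in> U\<close> in auto)
    have "continuous_on (V \<times> cbox (0::real) 1)
        (\<lambda>p. (\<lambda>z. deriv (\<lambda>e. F (fst z, e)) (snd z)) (t, e0 + of_real (snd p) * (fst p - e0)))"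
      by (intro comp[OF holomorphic2_on_eps_deriv[OF assms(1-4) F]] continuous_intros)
         (use mem \<open>t \<in> U\<close> in auto)
    then show "continuous_on (V \<times> cbox (0::real) 1)
        (\<lambda>(e, s). deriv (\<lambda>e. F (t, e)) (e0 + of_real s * (e - e0)) * of_real s)"
      unfolding split_beta by (auto intro!: continuous_intros)
  qed fact
qed fact+

text \<open>
  The quotient is the average of the \<open>e\<close>-derivative of \<open>f\<close> over the segment from \<open>e0\<close> to \<open>e\<close>, by
  the fundamental theorem of calculus.
\<close>

lemma holomorphic2_on_divide_eps:
  assumes "open U" "open V" "convex U" "convex V" "e0 \<in> V" and f: "holomorphic2_on f (U \<times> V)"
    and zero: "\<And>t. t \<in> U \<Longrightarrow> f (t, e0) = 0"
  shows "\<exists>g. holomorphic2_on g (U \<times> V) \<and> (\<forall>z\<in>U \<times> V. f z = (snd z - e0) * g z)"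
proof (intro exI conjI ballI)
  let ?F = "\<lambda>z. deriv (\<lambda>e. f (fst z, e)) (snd z)"
  show "holomorphic2_on (\<lambda>z. integral (cbox 0 1) (\<lambda>s. ?F (fst z, e0 + of_real s * (snd z - e0)))) (U \<times> V)"
    by (intro holomorphic2_on_segment_average holomorphic2_on_eps_deriv assms)
  fix z assume "z \<in> U \<times> V"
  then obtain t e where z: "z = (t, e)" "t \<in> U" "e \<in> V" by auto
  have "((\<lambda>s. f (t, e0 + of_real s * (e - e0))) has_vector_derivative
      (e - e0) * ?F (t, e0 + of_real s * (e - e0))) (at s within {0..1})" if "s \<in> {0..1::real}" for s
  proof -
    have "((\<lambda>e. f (t, e)) has_field_derivative ?F (t, e0 + of_real s * (e - e0)))
        (at (e0 + of_real s * (e - e0)))"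
      using convex_scaling_mem[OF assms(4,5) z(3) that] holomorphic2_on_imp_separately(3)[OF f z(2)] \<open>open V\<close>
      by (auto intro!: holomorphic_derivI)
    then have "((\<lambda>e. f (t, e)) has_field_derivative ?F (t, e0 + of_real s * (e - e0)))
        (at (e0 + of_real s * (e - e0)) within (\<lambda>s. e0 + of_real s * (e - e0)) ` {0..1})"
      by (rule has_field_derivative_at_within)
    moreover have "((\<lambda>s. e0 + of_real s * (e - e0)) has_vector_derivative (e - e0)) (at s within {0..1})"
      by (auto intro!: derivative_eq_intros)
    ultimately show ?thesis
      using field_vector_diff_chain_within[of "\<lambda>s. e0 + of_real s * (e - e0)" "e - e0" s "{0..1}" "\<lambda>e. f (t, e)"]
      by (simp add: o_def)
  qed
  then have "((\<lambda>s. (e - e0) * ?F (t, e0 + of_real s * (e - e0))) has_integral (f (t, e) - f (t, e0))) {0..1}"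
    using fundamental_theorem_of_calculus[of 0 1 "\<lambda>s. f (t, e0 + of_real s * (e - e0))"] by simp
  from integral_unique[OF this] zero[OF z(2)]
  show "f z = (snd z - e0) * integral (cbox 0 1) (\<lambda>s. ?F (fst z, e0 + of_real s * (snd z - e0)))"
    by (simp add: z)
qed

section \<open>The ring of holomorphic functions and the prime \<open>e - e0\<close>\<close>

lemma holomorphic2_on_const [simp]: "holomorphic2_on (\<lambda>z. c) S"
  unfolding holomorphic2_on_def by (auto intro!: exI[of _ 0] simp: has_derivative_const)

lemma holomorphic2_on_add:
  assumes "holomorphic2_on f S" "holomorphic2_on g S"
  shows "holomorphic2_on (\<lambda>z. f z + g z) S"
  unfolding holomorphic2_on_def
proof
  fix z assume "z \<in> S"
  then obtain a b a' b' where "(f has_derivative (\<lambda>h. a * fst h + b * snd h)) (at z within S)"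
      "(g has_derivative (\<lambda>h. a' * fst h + b' * snd h)) (at z within S)"
    using assms unfolding holomorphic2_on_def by meson
  from has_derivative_add[OF this]
  have "((\<lambda>z. f z + g z) has_derivative (\<lambda>h. (a + a') * fst h + (b + b') * snd h)) (at z within S)"
    by (simp add: algebra_simps)
  then show "\<exists>a b. ((\<lambda>z. f z + g z) has_derivative (\<lambda>h. a * fst h + b * snd h)) (at z within S)" by blast
qed

lemma holomorphic2_on_mult:
  assumes "holomorphic2_on f S" "holomorphic2_on g S"
  shows "holomorphic2_on (\<lambda>z. f z * g z) S"
  unfolding holomorphic2_on_def
proof
  fix z assume "z \<in> S"
  then obtain a b a' b' where "(f has_derivative (\<lambda>h. a * fst h + b * snd h)) (at z within S)"
      "(g has_derivative (\<lambda>h. a' * fst h + b' * snd h)) (at z within S)"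
    using assms unfolding holomorphic2_on_def by meson
  from has_derivative_mult[OF this]
  have "((\<lambda>z. f z * g z) has_derivative
      (\<lambda>h. (f z * a' + a * g z) * fst h + (f z * b' + b * g z) * snd h)) (at z within S)"
    by (simp add: algebra_simps)
  then show "\<exists>a b. ((\<lambda>z. f z * g z) has_derivative (\<lambda>h. a * fst h + b * snd h)) (at z within S)" by blast
qed

lemma holomorphic2_on_snd: "holomorphic2_on snd S"
proof -
  have "(snd has_derivative (\<lambda>h. 0 * fst h + 1 * snd h)) (at z within S)" for z
    by (auto intro!: derivative_eq_intros)
  then show ?thesis unfolding holomorphic2_on_def by blast
qed

lemma holomorphic2_on_uminus: "holomorphic2_on f S \<Longrightarrow> holomorphic2_on (\<lambda>z. - f z) S"
  using holomorphic2_on_mult[of "\<lambda>z. -1" S f] by simp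

lemma holomorphic2_on_diff:
  "holomorphic2_on f S \<Longrightarrow> holomorphic2_on g S \<Longrightarrow> holomorphic2_on (\<lambda>z. f z - g z) S"
  using holomorphic2_on_add[of f S "\<lambda>z. - g z"] holomorphic2_on_uminus[of g S] by simp

lemma holomorphic2_on_power: "holomorphic2_on f S \<Longrightarrow> holomorphic2_on (\<lambda>z. f z ^ m) S"
  by (induction m) (auto intro: holomorphic2_on_mult)

lemma holomorphic2_on_sum:
  "(\<And>i. i \<in> I \<Longrightarrow> holomorphic2_on (f i) S) \<Longrightarrow> holomorphic2_on (\<lambda>z. \<Sum>i\<in>I. f i z) S"
  by (induction I rule: infinite_finite_induct) (auto intro: holomorphic2_on_add)

lemmas holomorphic2_intros =
  holomorphic2_on_const holomorphic2_on_add holomorphic2_on_mult holomorphic2_on_snd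
  holomorphic2_on_uminus holomorphic2_on_diff holomorphic2_on_power holomorphic2_on_sum

lemma holomorphic_on_mult_eq_0:
  assumes "open S" "connected S" "F holomorphic_on S" "G holomorphic_on S"
    and prod: "\<And>z. z \<in> S \<Longrightarrow> F z * G z = 0" and "a \<in> S" "F a \<noteq> 0" "z \<in> S"
  shows "G z = 0"
proof -
  have "isCont F a"
    using assms holomorphic_on_imp_continuous_on continuous_on_eq_continuous_at by blast
  then obtain \<delta> where "\<delta> > 0" "\<And>y. dist a y < \<delta> \<Longrightarrow> F y \<noteq> 0"
    using \<open>F a \<noteq> 0\<close> continuous_at_avoid by (metis dist_commute)
  then have "G y = 0" if "y \<in> S \<inter> ball a \<delta>" for y
    using prod[of y] that by auto
  moreover have "open (S \<inter> ball a \<delta>)" "S \<inter> ball a \<delta> \<noteq> {}"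
    using assms \<open>\<delta> > 0\<close> by auto
  ultimately show ?thesis
    using analytic_continuation_open[of "S \<inter> ball a \<delta>" S G "\<lambda>_. 0" z] assms by auto
qed

text \<open>
  For the rest of the argument the ring is that of the functions holomorphic on \<open>U \<times> V\<close>, and \<open>e0\<close>
  is a fixed value of the parameter.
\<close>

locale bidisc =
  fixes U V :: "complex set" and e0 :: complex
  assumes open_U: "open U" and open_V: "open V" and convex_U: "convex U" and convex_V: "convex V"
    and e0: "e0 \<in> V"
begin

abbreviation hol :: "(complex \<times> complex \<Rightarrow> complex) \<Rightarrow> bool"
  where "hol f \<equiv> holomorphic2_on f (U \<times> V)"

text \<open>
  Since a holomorphic \<open>f\<close> is divisible by \<open>e - e0\<close> exactly when it vanishes on the fibre \<open>e = e0\<close>,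
  this says that \<open>f\<close> is a unit of the local ring at the prime \<open>e - e0\<close>.
\<close>

definition nonzero_on_fibre :: "(complex \<times> complex \<Rightarrow> complex) \<Rightarrow> bool"
  where "nonzero_on_fibre f \<longleftrightarrow> (\<exists>t\<in>U. f (t, e0) \<noteq> 0)"

lemma hol_time_deriv: "hol f \<Longrightarrow> hol (time_deriv f)"
  using holomorphic2_on_time_deriv[OF open_U open_V convex_V] .

lemmas hol_intros = holomorphic2_intros hol_time_deriv

text \<open>
  The ring is an integral domain. If \<open>a = (t1, e1)\<close> and \<open>z = (t, e)\<close>, then the one-variable statement
  in \<open>t\<close>, for each value of the parameter, gives \<open>f (t1, e) * g (t, e) = 0\<close> for all \<open>e\<close>; in the
  variable \<open>e\<close> it then gives the claim.
\<close>

lemma hol_mult_eq_0: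
  assumes f: "hol f" and g: "hol g" and prod: "\<And>z. z \<in> U \<times> V \<Longrightarrow> f z * g z = 0"
    and "a \<in> U \<times> V" "f a \<noteq> 0" "z \<in> U \<times> V"
  shows "g z = 0"
proof -
  obtain t e t1 e1 where z: "z = (t, e)" "t \<in> U" "e \<in> V" and a: "a = (t1, e1)" "t1 \<in> U" "e1 \<in> V"
    using assms by auto
  have row: "(\<lambda>e. f (t1, e)) holomorphic_on V" "\<And>t. t \<in> U \<Longrightarrow> (\<lambda>e. g (t, e)) holomorphic_on V"
    using holomorphic2_on_imp_separately(3)[OF f] holomorphic2_on_imp_separately(3)[OF g] a by auto
  have col: "\<And>e. e \<in> V \<Longrightarrow> (\<lambda>t. f (t, e)) holomorphic_on U" "\<And>e. e \<in> V \<Longrightarrow> (\<lambda>t. g (t, e)) holomorphic_on U"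
    using holomorphic2_on_imp_separately(2)[OF f] holomorphic2_on_imp_separately(2)[OF g] by auto
  have conn: "connected U" "connected V"
    using convex_U convex_V convex_connected by auto
  have "f (t1, e) * g (t, e) = 0" if "e \<in> V" for e
    using holomorphic_on_mult_eq_0[OF open_U conn(1) col(1)[OF that] col(2)[OF that] _ a(2) _ z(2)] prod that
    by fastforce
  then show ?thesis
    using holomorphic_on_mult_eq_0[OF open_V conn(2) row(1) row(2)[OF z(2)] _ a(3) _ z(3)] assms(5) a z
    by auto
qed

lemma hol_mult_nonzero:
  assumes "hol f" "hol g" "\<exists>z\<in>U \<times> V. f z \<noteq> 0" "\<exists>z\<in>U \<times> V. g z \<noteq> 0"
  shows "\<exists>z\<in>U \<times> V. f z * g z \<noteq> 0"
  using hol_mult_eq_0[OF assms(1,2)] assms(3,4) by blast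

text \<open>
  The element \<open>e - e0\<close> is prime.
\<close>

lemma nonzero_on_fibre_mult:
  assumes f: "hol f" and g: "hol g" and "nonzero_on_fibre f" "nonzero_on_fibre g"
  shows "nonzero_on_fibre (\<lambda>z. f z * g z)"
proof (rule ccontr)
  assume "\<not> ?thesis"
  then have "\<And>t. t \<in> U \<Longrightarrow> f (t, e0) * g (t, e0) = 0" by (simp add: nonzero_on_fibre_def)
  from holomorphic_on_mult_eq_0[OF open_U convex_connected[OF convex_U]
      holomorphic2_on_imp_separately(2)[OF f e0] holomorphic2_on_imp_separately(2)[OF g e0] this]
  show False using assms(3,4) unfolding nonzero_on_fibre_def by blast
qed

lemma eps_divides:
  assumes "hol f" "\<not> nonzero_on_fibre f"
  obtains g where "hol g" "\<And>z. z \<in> U \<times> V \<Longrightarrow> f z = (snd z - e0) * g z"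
  using holomorphic2_on_divide_eps[OF open_U open_V convex_U convex_V e0 assms(1)] assms(2)
  unfolding nonzero_on_fibre_def by blast

lemma eps_cancel:
  assumes "hol f" "\<And>z. z \<in> U \<times> V \<Longrightarrow> (snd z - e0) ^ m * f z = 0" "z \<in> U \<times> V"
  shows "f z = 0"
proof -
  have "V \<noteq> {e0}" using open_V not_open_singleton by metis
  then obtain e where "e \<in> V" "e \<noteq> e0" using e0 by blast
  then show ?thesis
    by (intro hol_mult_eq_0[of "\<lambda>z. (snd z - e0) ^ m" f "(fst z, e)" z] hol_intros assms)
       (use assms(3) in auto)
qed

end

text \<open>
  A nonconstant function is bounded below by \<open>k * norm (w - \<xi>) ^ n\<close> near a zero \<open>\<xi>\<close>, which is
  incompatible with divisibility by the power \<open>n + 1\<close>.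
\<close>

lemma holomorphic_on_infinite_order_zero:
  assumes "F holomorphic_on S" "open S" "connected S" "\<xi> \<in> S"
    and div: "\<And>m. \<exists>g. g holomorphic_on S \<and> (\<forall>w\<in>S. F w = (w - \<xi>) ^ m * g w)"
    and "w \<in> S"
  shows "F w = 0"
proof (rule ccontr)
  assume "F w \<noteq> 0"
  have "F \<xi> = 0" using div[of 1] \<open>\<xi> \<in> S\<close> by auto
  then obtain k n r where k: "0 < k" "0 < r" "ball \<xi> r \<subseteq> S"
    "\<And>w. w \<in> ball \<xi> r \<Longrightarrow> k * norm (w - \<xi>) ^ n \<le> norm (F w - F \<xi>)"
    using holomorphic_lower_bound_difference[OF assms(1-4) \<open>w \<in> S\<close>] \<open>F w \<noteq> 0\<close> by metis
  obtain g where g: "g holomorphic_on S" "\<And>w. w \<in> S \<Longrightarrow> F w = (w - \<xi>) ^ Suc n * g w"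
    using div[of "Suc n"] by blast
  have "isCont g \<xi>"
    using g(1) assms(2,4) holomorphic_on_imp_continuous_on continuous_on_eq_continuous_at by blast
  then have lim: "((\<lambda>w. norm ((w - \<xi>) * g w)) \<longlongrightarrow> norm ((\<xi> - \<xi>) * g \<xi>)) (at \<xi>)"
    unfolding isCont_def by (intro tendsto_intros)
  have "\<forall>\<^sub>F w in at \<xi>. k \<le> norm ((w - \<xi>) * g w)"
  proof -
    have "k \<le> norm ((w - \<xi>) * g w)" if w: "w \<noteq> \<xi>" "dist w \<xi> < r" for w
    proof -
      have "w \<in> ball \<xi> r" using w by (simp add: dist_commute)
      then have "k * norm (w - \<xi>) ^ n \<le> norm (w - \<xi>) ^ n * norm ((w - \<xi>) * g w)"
        using k(4)[of w] g(2)[of w] k(3) \<open>F \<xi> = 0\<close> by (auto simp: norm_mult norm_power mult_ac)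
      then show ?thesis
        using w by (simp add: mult.commute[of k])
    qed
    then show ?thesis
      using k(2) unfolding eventually_at by blast
  qed
  from tendsto_lowerbound[OF lim this] k(1) show False by simp
qed

context bidisc begin

lemma eps_infinitely_divisible:
  assumes f: "hol f" and div: "\<And>m. eps_power_dvd (U \<times> V) e0 m f" and z: "z \<in> U \<times> V"
  shows "f z = 0"
proof -
  obtain t e where te: "z = (t, e)" "t \<in> U" "e \<in> V" using z by auto
  have "\<exists>g. g holomorphic_on V \<and> (\<forall>w\<in>V. f (t, w) = (w - e0) ^ m * g w)" for m
  proof -
    obtain g where "hol g" "\<And>z. z \<in> U \<times> V \<Longrightarrow> f z = (snd z - e0) ^ m * g z"
      using div[of m] unfolding eps_power_dvd_def by blast
    then show ?thesis
      using holomorphic2_on_imp_separately(3)[of g U V t] te by (intro exI[of _ "\<lambda>w. g (t, w)"]) auto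
  qed
  from holomorphic_on_infinite_order_zero[OF holomorphic2_on_imp_separately(3)[OF f te(2)] open_V
      convex_connected[OF convex_V] e0 this te(3)]
  show ?thesis using te by simp
qed

text \<open>
  Gauss's content: a nonzero tuple is a power of \<open>e - e0\<close> times a primitive one. The power is the
  largest that divides all members; it exists as no nonzero function is infinitely divisible.
\<close>

lemma eps_content:
  fixes f :: "nat \<Rightarrow> complex \<times> complex \<Rightarrow> complex"
  assumes f: "\<And>i. i \<le> k \<Longrightarrow> hol (f i)" and nz: "\<exists>i\<le>k. \<exists>z\<in>U \<times> V. f i z \<noteq> 0"
  obtains c g where "\<And>i. i \<le> k \<Longrightarrow> hol (g i)"
    "\<And>i z. i \<le> k \<Longrightarrow> z \<in> U \<times> V \<Longrightarrow> f i z = (snd z - e0) ^ c * g i z"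
    "\<exists>i\<le>k. nonzero_on_fibre (g i)"
proof -
  define P where "P m \<longleftrightarrow> (\<forall>i\<le>k. eps_power_dvd (U \<times> V) e0 m (f i))" for m
  have "\<exists>m. \<not> P m"
    using eps_infinitely_divisible[OF f] nz unfolding P_def by metis
  moreover have "P 0" unfolding P_def eps_power_dvd_def using f by auto
  ultimately obtain c where c: "P c" "\<not> P (Suc c)"
    by (metis nat_induct)
  from c(1) have "\<exists>g. \<forall>i\<le>k. hol (g i) \<and> (\<forall>z\<in>U \<times> V. f i z = (snd z - e0) ^ c * g i z)"
    unfolding P_def eps_power_dvd_def by metis
  then obtain g where g: "\<And>i. i \<le> k \<Longrightarrow> hol (g i)"
    "\<And>i z. i \<le> k \<Longrightarrow> z \<in> U \<times> V \<Longrightarrow> f i z = (snd z - e0) ^ c * g i z" by blast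
  have "\<exists>i\<le>k. nonzero_on_fibre (g i)"
  proof (rule ccontr)
    assume no: "\<not> ?thesis"
    have "eps_power_dvd (U \<times> V) e0 (Suc c) (f i)" if i: "i \<le> k" for i
    proof -
      obtain g' where "hol g'" "\<And>z. z \<in> U \<times> V \<Longrightarrow> g i z = (snd z - e0) * g' z"
        using eps_divides[of "g i"] g(1)[OF i] no i by blast
      then show ?thesis
        unfolding eps_power_dvd_def using g(2)[OF i] by (intro exI[of _ g']) (auto simp: mult_ac)
    qed
    then show False using c(2) unfolding P_def by blast
  qed
  with g show ?thesis by (rule that)
qed

lemma common_denominator:
  fixes C :: "nat \<Rightarrow> complex \<times> complex \<Rightarrow> complex"
  assumes "\<And>i. i < k \<Longrightarrow> meromorphic2_on (C i) (U \<times> V)" and "U \<noteq> {}"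
  shows "\<exists>v p. hol v \<and> (\<exists>z\<in>U \<times> V. v z \<noteq> 0) \<and>
    (\<forall>i<k. hol (p i) \<and> (\<forall>z\<in>U \<times> V. v z \<noteq> 0 \<longrightarrow> v z * C i z = p i z))"
  using assms(1)
proof (induction k)
  case 0
  have "\<exists>z\<in>U \<times> V. (1::complex) \<noteq> 0" using \<open>U \<noteq> {}\<close> e0 by auto
  then show ?case using holomorphic2_on_const[of 1] by (metis less_nat_zero_code)
next
  case (Suc k)
  have "\<exists>v p. hol v \<and> (\<exists>z\<in>U \<times> V. v z \<noteq> 0) \<and>
      (\<forall>i<k. hol (p i) \<and> (\<forall>z\<in>U \<times> V. v z \<noteq> 0 \<longrightarrow> v z * C i z = p i z))"
    by (rule Suc.IH) (use Suc.prems in auto)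
  then obtain v p where v: "hol v" "\<exists>z\<in>U \<times> V. v z \<noteq> 0" "\<And>i. i < k \<Longrightarrow> hol (p i)"
    "\<And>i z. i < k \<Longrightarrow> z \<in> U \<times> V \<Longrightarrow> v z \<noteq> 0 \<Longrightarrow> v z * C i z = p i z"
    by blast
  obtain u' v' where u': "hol u'" "hol v'" "\<exists>z\<in>U \<times> V. v' z \<noteq> 0"
    "\<And>z. z \<in> U \<times> V \<Longrightarrow> v' z \<noteq> 0 \<Longrightarrow> C k z = u' z / v' z"
    using Suc.prems[of k] unfolding meromorphic2_on_def is_quotient_on_def by blast
  show ?case
  proof (intro exI conjI allI impI ballI)
    show "hol (\<lambda>z. v z * v' z)" by (intro hol_intros v u')
    show "\<exists>z\<in>U \<times> V. v z * v' z \<noteq> 0" by (intro hol_mult_nonzero v u')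
    show "hol ((\<lambda>i z. if i = k then u' z * v z else p i z * v' z) i)" if "i < Suc k" for i
      using that v(1,3) u'(1,2) by (cases "i = k") (auto intro!: hol_intros)
    show "v z * v' z * C i z = (\<lambda>i z. if i = k then u' z * v z else p i z * v' z) i z"
      if "i < Suc k" "z \<in> U \<times> V" "v z * v' z \<noteq> 0" for i z
      using that v(4)[of i z] u'(4)[of z] by (auto simp: less_Suc_eq mult_ac)
  qed
qed

section \<open>Linear dependence over the field of fractions\<close>

text \<open>
  Linear algebra over the field of fractions, with denominators cleared: if \<open>a 0, \<dots>, a d\<close> are
  independent, then some linear form kills \<open>a 0, \<dots>, a (d - 1)\<close> but not \<open>a d\<close>. The proof is
  Gaussian elimination: a nonzero entry of \<open>a 0\<close> is the pivot, and a relation or a form for the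
  remaining rows after elimination is transported back.
\<close>

lemma relation_or_separating_functional:
  fixes a :: "nat \<Rightarrow> 'j \<Rightarrow> complex \<times> complex \<Rightarrow> complex"
  assumes "finite J" and "\<And>i j. i \<le> d \<Longrightarrow> j \<in> J \<Longrightarrow> hol (a i j)" and "U \<noteq> {}"
  shows "(\<exists>c. (\<forall>i\<le>d. hol (c i)) \<and> (\<exists>i\<le>d. \<exists>z\<in>U \<times> V. c i z \<noteq> 0) \<and>
            (\<forall>j\<in>J. \<forall>z\<in>U \<times> V. (\<Sum>i\<le>d. c i z * a i j z) = 0))
    \<or> (\<exists>l. (\<forall>j\<in>J. hol (l j)) \<and> (\<forall>i<d. \<forall>z\<in>U \<times> V. (\<Sum>j\<in>J. l j z * a i j z) = 0) \<and>
            (\<exists>z\<in>U \<times> V. (\<Sum>j\<in>J. l j z * a d j z) \<noteq> 0))"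
  (is "?R d a \<or> ?L d a")
  using assms(2)
proof (induction d arbitrary: a)
  case 0
  show ?case
  proof (cases "\<exists>j\<in>J. \<exists>z\<in>U \<times> V. a 0 j z \<noteq> 0")
    case True
    then obtain j z where j: "j \<in> J" "z \<in> U \<times> V" "a 0 j z \<noteq> 0" by blast
    have "(\<Sum>i\<in>J. (if i = j then 1 else 0) * a 0 i z) = a 0 j z"
      using j \<open>finite J\<close> by (simp add: if_distrib[of "\<lambda>x. x * _"] cong: if_cong)
    then have "?L 0 a"
      using j by (intro exI[of _ "\<lambda>i z. if i = j then 1 else 0"] conjI bexI[of _ z]) auto
    then show ?thesis ..
  next
    case False
    have "?R 0 a"
      using False \<open>U \<noteq> {}\<close> e0 by (intro exI[of _ "\<lambda>i z. 1"]) auto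
    then show ?thesis ..
  qed
next
  case (Suc d)
  show ?case
  proof (cases "\<exists>j\<in>J. \<exists>z\<in>U \<times> V. a 0 j z \<noteq> 0")
    case False
    have "(\<Sum>i\<le>Suc d. (if i = 0 then 1 else 0) * a i j z) = a 0 j z" for j z
      by (simp add: if_distrib[of "\<lambda>x. x * _"] cong: if_cong)
    then have "?R (Suc d) a"
      using False \<open>U \<noteq> {}\<close> e0 by (intro exI[of _ "\<lambda>i z. if i = 0 then 1 else 0"]) auto
    then show ?thesis ..
  next
    case True
    then obtain q where q: "q \<in> J" "\<exists>z\<in>U \<times> V. a 0 q z \<noteq> 0" by blast
    \<comment> \<open>Row \<open>Suc i\<close> with its entry in the pivot column \<open>q\<close> eliminated.\<close>
    define b where "b = (\<lambda>i j z. a 0 q z * a (Suc i) j z - a (Suc i) q z * a 0 j z)"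
    have "hol (b i j)" if "i \<le> d" "j \<in> J" for i j
      unfolding b_def by (intro hol_intros Suc.prems) (use that q in auto)
    then consider "?R d b" | "?L d b" using Suc.IH[of b] by blast
    then show ?thesis
    proof cases
      case 1
      then obtain c where c: "\<And>i. i \<le> d \<Longrightarrow> hol (c i)" "\<exists>i\<le>d. \<exists>z\<in>U \<times> V. c i z \<noteq> 0"
        "\<And>j z. j \<in> J \<Longrightarrow> z \<in> U \<times> V \<Longrightarrow> (\<Sum>i\<le>d. c i z * b i j z) = 0" by blast
      define c' where "c' = (\<lambda>i z. case i of 0 \<Rightarrow> - (\<Sum>i\<le>d. c i z * a (Suc i) q z) | Suc i \<Rightarrow> c i z * a 0 q z)"
      have "hol (c' i)" if "i \<le> Suc d" for i
        using that c(1) Suc.prems q(1) unfolding c'_def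
        by (cases i) (auto intro!: hol_intros)
      moreover have "\<exists>i\<le>Suc d. \<exists>z\<in>U \<times> V. c' i z \<noteq> 0"
      proof -
        obtain i where i: "i \<le> d" "\<exists>z\<in>U \<times> V. c i z \<noteq> 0" using c(2) by blast
        have "\<exists>z\<in>U \<times> V. c i z * a 0 q z \<noteq> 0"
          by (intro hol_mult_nonzero c q i Suc.prems) auto
        then show ?thesis
          using i(1) by (intro exI[of _ "Suc i"]) (auto simp: c'_def)
      qed
      moreover have "(\<Sum>i\<le>Suc d. c' i z * a i j z) = 0" if "j \<in> J" "z \<in> U \<times> V" for j z
        using c(3)[OF that]
        by (simp add: sum.atMost_Suc_shift c'_def b_def right_diff_distrib sum_subtractf
            sum_distrib_left sum_distrib_right mult_ac del: sum.atMost_Suc)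
      ultimately have "?R (Suc d) a" by blast
      then show ?thesis ..
    next
      case 2
      then obtain l where l: "\<And>j. j \<in> J \<Longrightarrow> hol (l j)"
        "\<And>i z. i < d \<Longrightarrow> z \<in> U \<times> V \<Longrightarrow> (\<Sum>j\<in>J. l j z * b i j z) = 0"
        "\<exists>z\<in>U \<times> V. (\<Sum>j\<in>J. l j z * b d j z) \<noteq> 0" by blast
      \<comment> \<open>The value at \<open>q\<close> makes the form vanish on \<open>a 0\<close>; on the other rows it agrees with \<open>l\<close> on the
        eliminated rows, whose entries at \<open>q\<close> are zero.\<close>
      define l' where "l' = (\<lambda>j z. if j = q then - (\<Sum>j\<in>J - {q}. l j z * a 0 j z) else a 0 q z * l j z)"
      have expand: "(\<Sum>j\<in>J. l' j z * a i j z) =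
          (\<Sum>j\<in>J - {q}. l j z * (a 0 q z * a i j z - a i q z * a 0 j z))" for i z
        using \<open>finite J\<close> q(1)
        by (simp add: sum.remove[of J q] l'_def sum_distrib_left sum_distrib_right
            right_diff_distrib sum_subtractf mult_ac)
      have "(\<Sum>j\<in>J. l' j z * a 0 j z) = 0" for z
        unfolding expand by (simp add: mult.commute)
      moreover have "(\<Sum>j\<in>J. l' j z * a (Suc i) j z) = (\<Sum>j\<in>J. l j z * b i j z)" for i z
        unfolding expand using \<open>finite J\<close> q(1) by (simp add: sum.remove[of J q] b_def)
      moreover have "hol (l' j)" if "j \<in> J" for j
        using that l(1) Suc.prems q(1) unfolding l'_def
        by (cases "j = q") (auto intro!: hol_intros)
      ultimately have "?L (Suc d) a"
        using l(2,3) by (intro exI[of _ l']) (auto simp: less_Suc_eq_0_disj)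
      then show ?thesis ..
    qed
  qed
qed

end

section \<open>The module generated by the derived rows\<close>

context bidisc begin

lemma eps_power_dvd_cancel:
  assumes h: "hol h" "nonzero_on_fibre h" and f: "hol f"
    and "eps_power_dvd (U \<times> V) e0 m (\<lambda>z. h z * f z)"
  shows "eps_power_dvd (U \<times> V) e0 m f"
  using assms(3,4)
proof (induction m arbitrary: f)
  case 0
  then show ?case unfolding eps_power_dvd_def by auto
next
  case (Suc m)
  obtain g where g: "hol g" "\<And>z. z \<in> U \<times> V \<Longrightarrow> h z * f z = (snd z - e0) ^ Suc m * g z"
    using Suc.prems(2) unfolding eps_power_dvd_def by blast
  have "\<not> nonzero_on_fibre (\<lambda>z. h z * f z)"
    using g(2) e0 unfolding nonzero_on_fibre_def by auto
  then have "\<not> nonzero_on_fibre f" using nonzero_on_fibre_mult[OF h(1) Suc.prems(1) h(2)] by blast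
  then obtain f' where f': "hol f'" "\<And>z. z \<in> U \<times> V \<Longrightarrow> f z = (snd z - e0) * f' z"
    using eps_divides[OF Suc.prems(1)] by blast
  have "h z * f' z - (snd z - e0) ^ m * g z = 0" if z: "z \<in> U \<times> V" for z
  proof (rule eps_cancel[where m = 1])
    show "hol (\<lambda>z. h z * f' z - (snd z - e0) ^ m * g z)"
      by (intro hol_intros h f' g)
    show "(snd y - e0) ^ 1 * (h y * f' y - (snd y - e0) ^ m * g y) = 0" if "y \<in> U \<times> V" for y
      using g(2)[OF that] f'(2)[OF that] by (simp add: algebra_simps)
  qed (use z in auto)
  then have "eps_power_dvd (U \<times> V) e0 m (\<lambda>z. h z * f' z)"
    unfolding eps_power_dvd_def using g(1) by auto
  from Suc.IH[OF f'(1) this] obtain q where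
    "hol q" "\<And>z. z \<in> U \<times> V \<Longrightarrow> f' z = (snd z - e0) ^ m * q z"
    unfolding eps_power_dvd_def by blast
  then show ?case
    unfolding eps_power_dvd_def using f'(2) by (intro exI[of _ q]) (auto simp: mult_ac)
qed

lemma has_time_deriv:
  assumes "hol f" "z \<in> U \<times> V"
  shows "((\<lambda>t. f (t, snd z)) has_field_derivative time_deriv f z) (at (fst z))"
  using holomorphic_derivI[OF holomorphic2_on_imp_separately(2)[OF assms(1), of "snd z"] open_U, of "fst z" UNIV]
    assms(2) unfolding time_deriv_def by auto

lemma time_derivs_eq:
  assumes eq: "\<And>z. z \<in> U \<times> V \<Longrightarrow> f z = g z" and z: "z \<in> U \<times> V"
    and f: "((\<lambda>t. f (t, snd z)) has_field_derivative f') (at (fst z))"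
    and g: "((\<lambda>t. g (t, snd z)) has_field_derivative g') (at (fst z))"
  shows "f' = g'"
proof -
  have "((\<lambda>t. g (t, snd z)) has_field_derivative f') (at (fst z))"
    by (rule has_field_derivative_transform_within_open[OF f open_U]) (use z eq in auto)
  then show ?thesis using g DERIV_unique by blast
qed

end

locale holomorphic_system = bidisc +
  fixes n :: nat and A :: "nat \<Rightarrow> nat \<Rightarrow> complex \<times> complex \<Rightarrow> complex"
  assumes nonempty_U: "U \<noteq> {}"
    and hol_A: "\<And>i j. i \<in> {1..n} \<Longrightarrow> j \<in> {1..n} \<Longrightarrow> hol (A i j)"
begin

abbreviation a :: "nat \<Rightarrow> nat \<Rightarrow> complex \<times> complex \<Rightarrow> complex"
  where "a \<equiv> derived_row n A"

text \<open>
  The operator for which \<open>(w x)' = (total_deriv w) x\<close> along every solution \<open>x\<close> of the system, where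
  \<open>w x\<close> is the row \<open>w\<close> applied to the column \<open>x\<close>. The derived rows are its iterates on the first
  unit row, and it commutes with multiplication by \<open>e - e0\<close>, which is constant in time.
\<close>

definition total_deriv ::
    "(nat \<Rightarrow> complex \<times> complex \<Rightarrow> complex) \<Rightarrow> nat \<Rightarrow> complex \<times> complex \<Rightarrow> complex"
  where "total_deriv w = (\<lambda>j z. time_deriv (w j) z + (\<Sum>l=1..n. w l z * A l j z))"

lemma derived_row_Suc_total_deriv: "a (Suc i) = total_deriv (a i)"
  by (simp add: total_deriv_def)

declare derived_row.simps(2) [simp del]

lemma hol_total_deriv:
  assumes "\<And>j. j \<in> {1..n} \<Longrightarrow> hol (w j)" "j \<in> {1..n}"
  shows "hol (total_deriv w j)"
  unfolding total_deriv_def using assms by (intro hol_intros hol_A) auto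

lemma hol_row: "j \<in> {1..n} \<Longrightarrow> hol (a i j)"
proof (induction i arbitrary: j)
  case (Suc i)
  then show ?case unfolding derived_row_Suc_total_deriv by (intro hol_total_deriv) auto
qed simp

text \<open>
  Over the local ring at the prime \<open>e - e0\<close>, this is membership of \<open>w\<close> in the submodule generated
  by \<open>a 0, \<dots>, a (d - 1)\<close> and by \<open>(e - e0) ^ m\<close> times all rows. The factor \<open>h\<close> is the common
  denominator, so that only functions holomorphic on \<open>U \<times> V\<close> occur.
\<close>

definition in_span_mod_eps_power :: "nat \<Rightarrow> nat \<Rightarrow> (nat \<Rightarrow> complex \<times> complex \<Rightarrow> complex) \<Rightarrow> bool"
  where "in_span_mod_eps_power d m w \<longleftrightarrow>
    (\<exists>h r x. hol h \<and> nonzero_on_fibre h \<and> (\<forall>i<d. hol (r i)) \<and> (\<forall>j\<in>{1..n}. hol (x j)) \<and>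
      (\<forall>j\<in>{1..n}. \<forall>z\<in>U \<times> V. h z * w j z = (\<Sum>i<d. r i z * a i j z) + (snd z - e0) ^ m * x j z))"

lemma in_span_mod_eps_powerI:
  assumes "hol h" "nonzero_on_fibre h" "\<And>i. i < d \<Longrightarrow> hol (r i)" "\<And>j. j \<in> {1..n} \<Longrightarrow> hol (x j)"
    "\<And>j z. j \<in> {1..n} \<Longrightarrow> z \<in> U \<times> V \<Longrightarrow>
      h z * w j z = (\<Sum>i<d. r i z * a i j z) + (snd z - e0) ^ m * x j z"
  shows "in_span_mod_eps_power d m w"
  unfolding in_span_mod_eps_power_def using assms by blast

lemma in_span_mod_eps_powerE:
  assumes "in_span_mod_eps_power d m w"
  obtains h r x where "hol h" "nonzero_on_fibre h" "\<And>i. i < d \<Longrightarrow> hol (r i)" "\<And>j. j \<in> {1..n} \<Longrightarrow> hol (x j)"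
    "\<And>j z. j \<in> {1..n} \<Longrightarrow> z \<in> U \<times> V \<Longrightarrow>
      h z * w j z = (\<Sum>i<d. r i z * a i j z) + (snd z - e0) ^ m * x j z"
  using assms unfolding in_span_mod_eps_power_def by blast

lemma nonzero_on_fibre_1: "nonzero_on_fibre (\<lambda>z. 1)"
  using nonempty_U by (auto simp: nonzero_on_fibre_def)

lemma span_cong:
  assumes "in_span_mod_eps_power d m w"
    and "\<And>j z. j \<in> {1..n} \<Longrightarrow> z \<in> U \<times> V \<Longrightarrow> w j z = w' j z"
  shows "in_span_mod_eps_power d m w'"
  using assms unfolding in_span_mod_eps_power_def by simp

lemma span_row: "i < d \<Longrightarrow> in_span_mod_eps_power d m (a i)"
  by (rule in_span_mod_eps_powerI[of "\<lambda>z. 1" _ "\<lambda>i' z. if i' = i then 1 else 0" "\<lambda>j z. 0"])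
     (auto simp: nonzero_on_fibre_1 if_distrib[of "\<lambda>x. x * _"] cong: if_cong)

lemma span_eps_power_mult:
  assumes "\<And>j. j \<in> {1..n} \<Longrightarrow> hol (x j)"
  shows "in_span_mod_eps_power d m (\<lambda>j z. (snd z - e0) ^ m * x j z)"
  by (rule in_span_mod_eps_powerI[of "\<lambda>z. 1" _ "\<lambda>i z. 0" x]) (use assms in \<open>auto simp: nonzero_on_fibre_1\<close>)

lemma span_add:
  assumes "in_span_mod_eps_power d m w" "in_span_mod_eps_power d m w'"
  shows "in_span_mod_eps_power d m (\<lambda>j z. w j z + w' j z)"
proof -
  obtain h r x where h: "hol h" "nonzero_on_fibre h" "\<And>i. i < d \<Longrightarrow> hol (r i)" "\<And>j. j \<in> {1..n} \<Longrightarrow> hol (x j)"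
    "\<And>j z. j \<in> {1..n} \<Longrightarrow> z \<in> U \<times> V \<Longrightarrow>
      h z * w j z = (\<Sum>i<d. r i z * a i j z) + (snd z - e0) ^ m * x j z"
    using assms(1) by (rule in_span_mod_eps_powerE) blast
  obtain h' r' x' where h': "hol h'" "nonzero_on_fibre h'" "\<And>i. i < d \<Longrightarrow> hol (r' i)" "\<And>j. j \<in> {1..n} \<Longrightarrow> hol (x' j)"
    "\<And>j z. j \<in> {1..n} \<Longrightarrow> z \<in> U \<times> V \<Longrightarrow>
      h' z * w' j z = (\<Sum>i<d. r' i z * a i j z) + (snd z - e0) ^ m * x' j z"
    using assms(2) by (rule in_span_mod_eps_powerE) blast
  show ?thesis
  proof (rule in_span_mod_eps_powerI)
    show "hol (\<lambda>z. h z * h' z)" by (intro hol_intros h h')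
    show "nonzero_on_fibre (\<lambda>z. h z * h' z)" by (intro nonzero_on_fibre_mult h h')
    show "hol ((\<lambda>i z. h' z * r i z + h z * r' i z) i)" if "i < d" for i
      by (intro hol_intros h h' that)
    show "hol ((\<lambda>j z. h' z * x j z + h z * x' j z) j)" if "j \<in> {1..n}" for j
      by (intro hol_intros h h' that)
    show "h z * h' z * (w j z + w' j z) = (\<Sum>i<d. (h' z * r i z + h z * r' i z) * a i j z)
        + (snd z - e0) ^ m * (h' z * x j z + h z * x' j z)" if "j \<in> {1..n}" "z \<in> U \<times> V" for j z
    proof -
      have "h z * h' z * (w j z + w' j z) = h' z * (h z * w j z) + h z * (h' z * w' j z)"
        by (simp add: algebra_simps)
      then show ?thesis
        unfolding h(5)[OF that] h'(5)[OF that]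
        by (simp add: algebra_simps sum_distrib_left sum.distrib)
    qed
  qed
qed

lemma span_scale:
  assumes "in_span_mod_eps_power d m w" and f: "hol f"
  shows "in_span_mod_eps_power d m (\<lambda>j z. f z * w j z)"
proof -
  obtain h r x where h: "hol h" "nonzero_on_fibre h" "\<And>i. i < d \<Longrightarrow> hol (r i)" "\<And>j. j \<in> {1..n} \<Longrightarrow> hol (x j)"
    "\<And>j z. j \<in> {1..n} \<Longrightarrow> z \<in> U \<times> V \<Longrightarrow>
      h z * w j z = (\<Sum>i<d. r i z * a i j z) + (snd z - e0) ^ m * x j z"
    using assms(1) by (rule in_span_mod_eps_powerE) blast
  show ?thesis
  proof (rule in_span_mod_eps_powerI[OF h(1,2)])
    show "hol ((\<lambda>i z. f z * r i z) i)" if "i < d" for i by (intro hol_intros h f that)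
    show "hol ((\<lambda>j z. f z * x j z) j)" if "j \<in> {1..n}" for j by (intro hol_intros h f that)
    show "h z * (f z * w j z) = (\<Sum>i<d. f z * r i z * a i j z) + (snd z - e0) ^ m * (f z * x j z)"
      if "j \<in> {1..n}" "z \<in> U \<times> V" for j z
    proof -
      have "h z * (f z * w j z) = f z * (h z * w j z)" by simp
      then show ?thesis
        unfolding h(5)[OF that] by (simp add: algebra_simps sum_distrib_left)
    qed
  qed
qed

lemma span_sum:
  assumes "\<And>i. i \<in> I \<Longrightarrow> in_span_mod_eps_power d m (w i)"
  shows "in_span_mod_eps_power d m (\<lambda>j z. \<Sum>i\<in>I. w i j z)"
proof -
  have 0: "in_span_mod_eps_power d m (\<lambda>j z. 0)"
    using span_eps_power_mult[of "\<lambda>j z. 0"] by simp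
  show ?thesis using assms
    by (induction I rule: infinite_finite_induct) (auto simp: 0 intro: span_add)
qed

text \<open>
  This is the gain from localizing: functions that do not vanish on the fibre can be cancelled.
\<close>

lemma span_cancel:
  assumes "in_span_mod_eps_power d m (\<lambda>j z. f z * w j z)" and f: "hol f" "nonzero_on_fibre f"
  shows "in_span_mod_eps_power d m w"
proof -
  obtain h r x where h: "hol h" "nonzero_on_fibre h" "\<And>i. i < d \<Longrightarrow> hol (r i)" "\<And>j. j \<in> {1..n} \<Longrightarrow> hol (x j)"
    "\<And>j z. j \<in> {1..n} \<Longrightarrow> z \<in> U \<times> V \<Longrightarrow>
      h z * (f z * w j z) = (\<Sum>i<d. r i z * a i j z) + (snd z - e0) ^ m * x j z"
    using assms(1) by (rule in_span_mod_eps_powerE) blast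
  show ?thesis
    by (rule in_span_mod_eps_powerI[of "\<lambda>z. h z * f z" _ r x])
       (use h f in \<open>auto simp: mult.assoc intro: hol_intros nonzero_on_fibre_mult\<close>)
qed

lemma span_eps_mult:
  assumes "in_span_mod_eps_power d m w"
  shows "in_span_mod_eps_power d (Suc m) (\<lambda>j z. (snd z - e0) * w j z)"
proof -
  obtain h r x where h: "hol h" "nonzero_on_fibre h" "\<And>i. i < d \<Longrightarrow> hol (r i)" "\<And>j. j \<in> {1..n} \<Longrightarrow> hol (x j)"
    "\<And>j z. j \<in> {1..n} \<Longrightarrow> z \<in> U \<times> V \<Longrightarrow>
      h z * w j z = (\<Sum>i<d. r i z * a i j z) + (snd z - e0) ^ m * x j z"
    using assms(1) by (rule in_span_mod_eps_powerE) blast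
  show ?thesis
  proof (rule in_span_mod_eps_powerI[OF h(1,2) _ h(4)])
    show "hol ((\<lambda>i z. (snd z - e0) * r i z) i)" if "i < d" for i by (intro hol_intros h that)
    show "h z * ((snd z - e0) * w j z) =
        (\<Sum>i<d. (snd z - e0) * r i z * a i j z) + (snd z - e0) ^ Suc m * x j z"
      if "j \<in> {1..n}" "z \<in> U \<times> V" for j z
    proof -
      have "h z * ((snd z - e0) * w j z) = (snd z - e0) * (h z * w j z)" by simp
      then show ?thesis
        unfolding h(5)[OF that] by (simp add: distrib_left sum_distrib_left mult.assoc)
    qed
  qed
qed

text \<open>
  Differentiate the equation that expresses \<open>h w\<close>. By the product rule every term stays in the
  submodule, except that the derivative of \<open>a (d - 1)\<close> brings in \<open>a d\<close>; hence the last hypothesis.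
\<close>

lemma span_total_deriv:
  assumes "in_span_mod_eps_power d m w" and w: "\<And>j. j \<in> {1..n} \<Longrightarrow> hol (w j)"
    and top: "in_span_mod_eps_power d m (a d)"
  shows "in_span_mod_eps_power d m (total_deriv w)"
proof -
  obtain h r x where h: "hol h" "nonzero_on_fibre h" "\<And>i. i < d \<Longrightarrow> hol (r i)" "\<And>j. j \<in> {1..n} \<Longrightarrow> hol (x j)"
    "\<And>j z. j \<in> {1..n} \<Longrightarrow> z \<in> U \<times> V \<Longrightarrow>
      h z * w j z = (\<Sum>i<d. r i z * a i j z) + (snd z - e0) ^ m * x j z"
    using assms(1) by (rule in_span_mod_eps_powerE) blast
  have next_row: "in_span_mod_eps_power d m (a (Suc i))" if "i < d" for i
    using that top span_row by (cases "Suc i = d") auto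
  have "in_span_mod_eps_power d m (\<lambda>j z. (\<Sum>i<d. time_deriv (r i) z * a i j z + r i z * a (Suc i) j z)
      + (snd z - e0) ^ m * total_deriv x j z + (- time_deriv h z) * w j z)"
    by (intro span_add span_sum span_scale span_row next_row span_eps_power_mult hol_total_deriv
        hol_intros h assms(1)) auto
  moreover have "(\<Sum>i<d. time_deriv (r i) z * a i j z + r i z * a (Suc i) j z)
      + (snd z - e0) ^ m * total_deriv x j z + (- time_deriv h z) * w j z = h z * total_deriv w j z"
    if j: "j \<in> {1..n}" and z: "z \<in> U \<times> V" for j z
  proof -
    have "time_deriv h z * w j z + h z * time_deriv (w j) z =
        (\<Sum>i<d. time_deriv (r i) z * a i j z + r i z * time_deriv (a i j) z)
          + (snd z - e0) ^ m * time_deriv (x j) z"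
    proof (rule time_derivs_eq[OF h(5)[OF j] z])
      show "((\<lambda>t. h (t, snd z) * w j (t, snd z)) has_field_derivative
          time_deriv h z * w j z + h z * time_deriv (w j) z) (at (fst z))"
        by (rule DERIV_cong[OF DERIV_mult[OF has_time_deriv[OF h(1) z] has_time_deriv[OF w[OF j] z]]]) simp
      have "((\<lambda>t. r i (t, snd z) * a i j (t, snd z)) has_field_derivative
          time_deriv (r i) z * a i j z + r i z * time_deriv (a i j) z) (at (fst z))" if "i < d" for i
        by (rule DERIV_cong[OF DERIV_mult[OF has_time_deriv[OF h(3)[OF that] z] has_time_deriv[OF hol_row[OF j] z]]]) simp
      then show "((\<lambda>t. (\<Sum>i<d. r i (t, snd z) * a i j (t, snd z)) +
          (snd (t, snd z) - e0) ^ m * x j (t, snd z)) has_field_derivative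
          (\<Sum>i<d. time_deriv (r i) z * a i j z + r i z * time_deriv (a i j) z)
          + (snd z - e0) ^ m * time_deriv (x j) z) (at (fst z))"
        unfolding snd_conv
        by (intro DERIV_add DERIV_sum DERIV_cmult has_time_deriv h j z) auto
    qed
    moreover have "h z * (\<Sum>l=1..n. w l z * A l j z) =
        (\<Sum>i<d. r i z * (\<Sum>l=1..n. a i l z * A l j z)) + (snd z - e0) ^ m * (\<Sum>l=1..n. x l z * A l j z)"
    proof -
      have "h z * (\<Sum>l=1..n. w l z * A l j z) = (\<Sum>l=1..n. (h z * w l z) * A l j z)"
        by (simp add: sum_distrib_left mult.assoc)
      also have "\<dots> = (\<Sum>l=1..n. ((\<Sum>i<d. r i z * a i l z) + (snd z - e0) ^ m * x l z) * A l j z)"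
        using h(5)[OF _ z] by (intro sum.cong) auto
      also have "\<dots> = (\<Sum>l=1..n. \<Sum>i<d. r i z * a i l z * A l j z)
          + (snd z - e0) ^ m * (\<Sum>l=1..n. x l z * A l j z)"
        by (simp add: distrib_right sum.distrib sum_distrib_left sum_distrib_right mult.assoc)
      also have "(\<Sum>l=1..n. \<Sum>i<d. r i z * a i l z * A l j z) =
          (\<Sum>i<d. r i z * (\<Sum>l=1..n. a i l z * A l j z))"
        by (subst sum.swap) (simp add: sum_distrib_left mult.assoc)
      finally show ?thesis .
    qed
    ultimately show ?thesis
      by (simp add: derived_row_Suc_total_deriv total_deriv_def distrib_left sum.distrib algebra_simps)
  qed
  ultimately have "in_span_mod_eps_power d m (\<lambda>j z. h z * total_deriv w j z)"
    by (rule span_cong)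
  then show ?thesis using h(1,2) by (rule span_cancel)
qed

text \<open>
  Modulo \<open>e - e0\<close> the relation has order \<open>d\<close> with invertible leading coefficient \<open>p d\<close>, so \<open>a d\<close> is a
  combination of the earlier rows plus \<open>e - e0\<close> times the later ones. Knowing that all rows lie in
  the submodule for \<open>m\<close>, one gets \<open>a d\<close> for \<open>m + 1\<close>, and then all rows for \<open>m + 1\<close> by
  differentiating.
\<close>

lemma rows_in_span_mod_eps_power:
  assumes "d < k" and p: "\<And>i. i \<le> k \<Longrightarrow> hol (p i)" and pd: "nonzero_on_fibre (p d)"
    and high: "\<And>i. d < i \<Longrightarrow> i \<le> k \<Longrightarrow> \<not> nonzero_on_fibre (p i)"
    and rel: "\<And>j z. j \<in> {1..n} \<Longrightarrow> z \<in> U \<times> V \<Longrightarrow> (\<Sum>i\<le>k. p i z * a i j z) = 0"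
  shows "in_span_mod_eps_power d m (a i)"
proof (induction m arbitrary: i)
  case 0
  show ?case
    by (rule in_span_mod_eps_powerI[of "\<lambda>z. 1" _ "\<lambda>i z. 0" "a i"]) (auto simp: nonzero_on_fibre_1 hol_row)
next
  case (Suc m)
  have "\<exists>g. hol g \<and> (\<forall>z\<in>U \<times> V. p i z = (snd z - e0) * g z)" if i: "i \<in> {d<..k}" for i
    using eps_divides[OF p high, of i] i by (metis greaterThanAtMost_iff)
  then obtain g where g: "\<And>i. i \<in> {d<..k} \<Longrightarrow> hol (g i)"
    "\<And>i z. i \<in> {d<..k} \<Longrightarrow> z \<in> U \<times> V \<Longrightarrow> p i z = (snd z - e0) * g i z" by metis
  have "in_span_mod_eps_power d (Suc m) (\<lambda>j z. (\<Sum>i<d. (- p i z) * a i j z)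
      + (\<Sum>i\<in>{d<..k}. (- g i z) * ((snd z - e0) * a i j z)))"
    by (intro span_add span_sum span_scale span_row span_eps_mult Suc.IH hol_intros p g)
       (use \<open>d < k\<close> in auto)
  moreover have "(\<Sum>i<d. (- p i z) * a i j z) + (\<Sum>i\<in>{d<..k}. (- g i z) * ((snd z - e0) * a i j z))
      = p d z * a d j z" if "j \<in> {1..n}" "z \<in> U \<times> V" for j z
  proof -
    have "{..k} = insert d ({..<d} \<union> {d<..k})" using \<open>d < k\<close> by auto
    moreover have "(\<Sum>i\<in>{..<d} \<union> {d<..k}. p i z * a i j z) =
        (\<Sum>i<d. p i z * a i j z) + (\<Sum>i\<in>{d<..k}. p i z * a i j z)"
      by (rule sum.union_disjoint) auto
    ultimately have "(\<Sum>i\<le>k. p i z * a i j z) =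
        (\<Sum>i<d. p i z * a i j z) + p d z * a d j z + (\<Sum>i\<in>{d<..k}. p i z * a i j z)"
      by simp
    moreover have "(\<Sum>i\<in>{d<..k}. p i z * a i j z) = (\<Sum>i\<in>{d<..k}. g i z * ((snd z - e0) * a i j z))"
      using g(2)[OF _ that(2)] by (intro sum.cong) (auto simp: mult_ac)
    ultimately show ?thesis
      using rel[OF that] unfolding minus_mult_left[symmetric] sum_negf by algebra
  qed
  ultimately have "in_span_mod_eps_power d (Suc m) (\<lambda>j z. p d z * a d j z)"
    by (rule span_cong)
  then have top: "in_span_mod_eps_power d (Suc m) (a d)"
    by (rule span_cancel) (use p pd \<open>d < k\<close> in auto)
  show ?case
  proof (induction i)
    case 0
    show ?case using top span_row[of 0 d] by (cases "d = 0") (simp_all del: derived_row.simps)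
  next
    case (Suc i)
    then show ?case
      unfolding derived_row_Suc_total_deriv by (rule span_total_deriv) (simp_all add: hol_row top)
  qed
qed

text \<open>
  The heart of the matter. If the leading coefficient vanished on the fibre, the relation would have
  a smaller order \<open>d\<close> there. Then \<open>a d\<close> would be a combination of \<open>a 0, \<dots>, a (d - 1)\<close> up to an
  arbitrarily high power of \<open>e - e0\<close>. A linear form that kills these rows but not \<open>a d\<close> would then
  take on \<open>a d\<close> a nonzero value that is divisible by all powers of \<open>e - e0\<close>.
\<close>

lemma primitive_relation_keeps_order:
  assumes p: "\<And>i. i \<le> k \<Longrightarrow> hol (p i)" and prim: "\<exists>i\<le>k. nonzero_on_fibre (p i)"
    and rel: "\<And>j z. j \<in> {1..n} \<Longrightarrow> z \<in> U \<times> V \<Longrightarrow> (\<Sum>i\<le>k. p i z * a i j z) = 0"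
    and indep: "\<And>m. m < k \<Longrightarrow> \<not> mero_dependent (U \<times> V) n a m"
  shows "nonzero_on_fibre (p k)"
proof (rule ccontr)
  assume notk: "\<not> nonzero_on_fibre (p k)"
  define d where "d = (GREATEST i. i \<le> k \<and> nonzero_on_fibre (p i))"
  have d: "d \<le> k \<and> nonzero_on_fibre (p d)"
    unfolding d_def by (rule GreatestI_ex_nat[OF prim]) auto
  have high: "\<not> nonzero_on_fibre (p i)" if "d < i" "i \<le> k" for i
    using Greatest_le_nat[of "\<lambda>i. i \<le> k \<and> nonzero_on_fibre (p i)" i k] that unfolding d_def by fastforce
  have "d < k" using d notk by (cases "d = k") auto
  have no_rel: "\<not> (\<exists>c. (\<forall>i\<le>d. hol (c i)) \<and> (\<exists>i\<le>d. \<exists>z\<in>U \<times> V. c i z \<noteq> 0) \<and>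
            (\<forall>j\<in>{1..n}. \<forall>z\<in>U \<times> V. (\<Sum>i\<le>d. c i z * a i j z) = 0))"
  proof
    assume "\<exists>c. (\<forall>i\<le>d. hol (c i)) \<and> (\<exists>i\<le>d. \<exists>z\<in>U \<times> V. c i z \<noteq> 0) \<and>
            (\<forall>j\<in>{1..n}. \<forall>z\<in>U \<times> V. (\<Sum>i\<le>d. c i z * a i j z) = 0)"
    then obtain c i where c: "\<forall>i\<le>d. hol (c i)" "i \<le> d" "\<exists>z\<in>U \<times> V. c i z \<noteq> 0"
      "\<forall>j\<in>{1..n}. \<forall>z\<in>U \<times> V. (\<Sum>i\<le>d. c i z * a i j z) = 0" by blast
    have one: "hol (\<lambda>z. 1)" "\<exists>z\<in>U \<times> V. (1::complex) \<noteq> 0" using nonempty_U e0 by auto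
    have "meromorphic2_on (c i) (U \<times> V)" if "i \<le> d" for i
      unfolding meromorphic2_on_def is_quotient_on_def
      by (rule exI[of _ "c i"], rule exI[of _ "\<lambda>z. 1"]) (use one c(1) that in auto)
    moreover have "\<not> mero_eq_on (U \<times> V) (c i) (\<lambda>z. 0)"
    proof
      assume "mero_eq_on (U \<times> V) (c i) (\<lambda>z. 0)"
      then obtain w where "hol w" "\<exists>z\<in>U \<times> V. w z \<noteq> 0" "\<And>z. z \<in> U \<times> V \<Longrightarrow> w z \<noteq> 0 \<Longrightarrow> c i z = 0"
        unfolding mero_eq_on_def by blast
      then show False
        using hol_mult_nonzero[of w "c i"] c(1-3) by auto
    qed
    moreover have "mero_eq_on (U \<times> V) (\<lambda>z. \<Sum>i\<le>d. c i z * a i j z) (\<lambda>z. 0)" if "j \<in> {1..n}" for j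
      unfolding mero_eq_on_def by (rule exI[of _ "\<lambda>z. 1"]) (use one c(4) that in auto)
    ultimately have "mero_dependent (U \<times> V) n a d"
      unfolding mero_dependent_def using c(2) by blast
    then show False using indep[OF \<open>d < k\<close>] by blast
  qed
  have "\<exists>l. (\<forall>j\<in>{1..n}. hol (l j)) \<and> (\<forall>i<d. \<forall>z\<in>U \<times> V. (\<Sum>j\<in>{1..n}. l j z * a i j z) = 0) \<and>
            (\<exists>z\<in>U \<times> V. (\<Sum>j\<in>{1..n}. l j z * a d j z) \<noteq> 0)"
    by (rule mp[OF disj_imp[THEN iffD1,
          OF relation_or_separating_functional[of "{1..n}" d a, OF finite_atLeastAtMost hol_row nonempty_U]] no_rel])
  then obtain l where l: "\<And>j. j \<in> {1..n} \<Longrightarrow> hol (l j)"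
    "\<And>i z. i < d \<Longrightarrow> z \<in> U \<times> V \<Longrightarrow> (\<Sum>j\<in>{1..n}. l j z * a i j z) = 0"
    "\<exists>z\<in>U \<times> V. (\<Sum>j\<in>{1..n}. l j z * a d j z) \<noteq> 0"
    by blast
  define f where "f = (\<lambda>z. \<Sum>j\<in>{1..n}. l j z * a d j z)"
  have f: "hol f" unfolding f_def by (intro hol_intros l hol_row)
  have "eps_power_dvd (U \<times> V) e0 m f" for m
  proof -
    have "in_span_mod_eps_power d m (a d)"
      using rows_in_span_mod_eps_power[OF \<open>d < k\<close> p _ high rel] d by blast
    then obtain h r x where h: "hol h" "nonzero_on_fibre h" "\<And>i. i < d \<Longrightarrow> hol (r i)"
      "\<And>j. j \<in> {1..n} \<Longrightarrow> hol (x j)"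
      "\<And>j z. j \<in> {1..n} \<Longrightarrow> z \<in> U \<times> V \<Longrightarrow>
        h z * a d j z = (\<Sum>i<d. r i z * a i j z) + (snd z - e0) ^ m * x j z"
      by (rule in_span_mod_eps_powerE) blast
    have "h z * f z = (snd z - e0) ^ m * (\<Sum>j\<in>{1..n}. l j z * x j z)" if z: "z \<in> U \<times> V" for z
    proof -
      have "h z * f z = (\<Sum>j\<in>{1..n}. l j z * (h z * a d j z))"
        unfolding f_def by (simp add: sum_distrib_left mult_ac)
      also have "\<dots> = (\<Sum>j\<in>{1..n}. l j z * ((\<Sum>i<d. r i z * a i j z) + (snd z - e0) ^ m * x j z))"
        using h(5)[OF _ z] by (intro sum.cong) auto
      also have "\<dots> = (\<Sum>j\<in>{1..n}. \<Sum>i<d. r i z * (l j z * a i j z))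
          + (snd z - e0) ^ m * (\<Sum>j\<in>{1..n}. l j z * x j z)"
        by (simp add: distrib_left sum.distrib sum_distrib_left mult_ac)
      also have "(\<Sum>j\<in>{1..n}. \<Sum>i<d. r i z * (l j z * a i j z)) =
          (\<Sum>i<d. r i z * (\<Sum>j\<in>{1..n}. l j z * a i j z))"
        by (subst sum.swap) (simp add: sum_distrib_left)
      also have "\<dots> = 0" using l(2)[OF _ z] by simp
      finally show ?thesis by simp
    qed
    then have "eps_power_dvd (U \<times> V) e0 m (\<lambda>z. h z * f z)"
      unfolding eps_power_dvd_def
      by (intro exI[of _ "\<lambda>z. \<Sum>j\<in>{1..n}. l j z * x j z"] conjI hol_intros l h) auto
    then show ?thesis using eps_power_dvd_cancel[OF h(1,2) f] by blast
  qed
  then show False using eps_infinitely_divisible[OF f] l(3) unfolding f_def by blast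
qed

end

section \<open>Absence of singular perturbation\<close>

theorem theorem2:
  fixes t_c e_c :: complex and r s :: real and n k :: nat
    and A :: "nat \<Rightarrow> nat \<Rightarrow> complex \<times> complex \<Rightarrow> complex"
    and b :: "nat \<Rightarrow> complex \<times> complex \<Rightarrow> complex"
    and U V :: "complex set"
  assumes "r > 0" and "U = ball t_c r"
    and "s > 0" and "V = ball e_c s"
    and "n \<ge> 1"
    and "\<And>i j. i \<in> {1..n} \<Longrightarrow> j \<in> {1..n} \<Longrightarrow> holomorphic2_on (A i j) (U \<times> V)"
    and "derived_equation (U \<times> V) n A k b"
  shows "\<not> singularly_perturbed_equation U V k b"
proof
  assume "singularly_perturbed_equation U V k b"
  then obtain i e0 where "i \<le> k" "e0 \<in> V" and sing: "singularly_perturbed_at (U \<times> V) (b i) e0"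
    unfolding singularly_perturbed_equation_def by blast
  interpret holomorphic_system U V e0 n A
    by unfold_locales (use assms \<open>e0 \<in> V\<close> in auto)
  obtain C where indep: "\<And>m. m < k \<Longrightarrow> \<not> mero_dependent (U \<times> V) n a m"
    and C: "\<And>i. i < k \<Longrightarrow> meromorphic2_on (C i) (U \<times> V)"
    and rel: "\<And>j. j \<in> {1..n} \<Longrightarrow> mero_eq_on (U \<times> V) (a k j) (\<lambda>z. \<Sum>i<k. C i z * a i j z)"
    and b: "b k = (\<lambda>z. 1)" "\<And>i. i < k \<Longrightarrow> b i = (\<lambda>z. - C i z)"
    using assms(7) unfolding derived_equation_def by blast
  \<comment> \<open>Clearing denominators turns the derived equation into a holomorphic relation with leading
    coefficient \<open>f k = v\<close>; by the identity theorem it holds on all of \<open>U \<times> V\<close>.\<close>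
  obtain v p where v: "hol v" "\<exists>z\<in>U \<times> V. v z \<noteq> 0" and p: "\<And>i. i < k \<Longrightarrow> hol (p i)"
    and vC: "\<And>i z. i < k \<Longrightarrow> z \<in> U \<times> V \<Longrightarrow> v z \<noteq> 0 \<Longrightarrow> v z * C i z = p i z"
    using common_denominator[of k C, OF C nonempty_U] by blast
  define f where "f i = (if i = k then v else (\<lambda>z. - p i z))" for i
  have f: "hol (f i)" if "i \<le> k" for i
    unfolding f_def using that v p by (auto intro: holomorphic2_on_uminus)
  have f_b: "f k z * b i z = f i z" if "i \<le> k" "z \<in> U \<times> V" "v z \<noteq> 0" for i z
    using that vC[of i z] b by (cases "i = k") (auto simp: f_def)
  have f_rel: "(\<Sum>i\<le>k. f i z * a i j z) = 0" if j: "j \<in> {1..n}" and z: "z \<in> U \<times> V" for j z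
  proof -
    obtain w where w: "hol w" "\<exists>z\<in>U \<times> V. w z \<noteq> 0"
      "\<And>z. z \<in> U \<times> V \<Longrightarrow> w z \<noteq> 0 \<Longrightarrow> a k j z = (\<Sum>i<k. C i z * a i j z)"
      using rel[OF j] unfolding mero_eq_on_def by blast
    obtain y where y: "y \<in> U \<times> V" "w y * v y \<noteq> 0"
      using hol_mult_nonzero[OF w(1) v(1) w(2) v(2)] by blast
    show ?thesis
    proof (rule hol_mult_eq_0[of "\<lambda>z. w z * v z" "\<lambda>z. \<Sum>i\<le>k. f i z * a i j z", OF _ _ _ y z])
      show "hol (\<lambda>z. w z * v z)" by (intro hol_intros w v)
      show "hol (\<lambda>z. \<Sum>i\<le>k. f i z * a i j z)" by (intro hol_intros f hol_row j) auto
      fix x assume x: "x \<in> U \<times> V"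
      show "w x * v x * (\<Sum>i\<le>k. f i x * a i j x) = 0"
      proof (cases "w x * v x = 0")
        case False
        have "(\<Sum>i<k. f i x * a i j x) = - (\<Sum>i<k. v x * C i x * a i j x)"
          unfolding sum_negf[symmetric] using vC[OF _ x] False by (intro sum.cong) (auto simp: f_def)
        also have "\<dots> = - (v x * a k j x)"
          using w(3)[OF x] False by (simp add: sum_distrib_left mult.assoc)
        finally show ?thesis
          by (simp add: lessThan_Suc_atMost[symmetric] f_def)
      qed simp
    qed
  qed
  \<comment> \<open>Divide by the content, so that \<open>primitive_relation_keeps_order\<close> applies to the quotients \<open>g\<close>.\<close>
  obtain c g where g: "\<And>i. i \<le> k \<Longrightarrow> hol (g i)" and prim: "\<exists>i\<le>k. nonzero_on_fibre (g i)"
    and fg: "\<And>i z. i \<le> k \<Longrightarrow> z \<in> U \<times> V \<Longrightarrow> f i z = (snd z - e0) ^ c * g i z"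
    by (rule eps_content[of k f]) (use f v(2) in \<open>auto simp: f_def\<close>)
  have g_rel: "(\<Sum>i\<le>k. g i z * a i j z) = 0" if "j \<in> {1..n}" "z \<in> U \<times> V" for j z
  proof (rule eps_cancel[of _ c])
    show "hol (\<lambda>z. \<Sum>i\<le>k. g i z * a i j z)" by (intro hol_intros g hol_row that) auto
    show "(snd y - e0) ^ c * (\<Sum>i\<le>k. g i y * a i j y) = 0" if "y \<in> U \<times> V" for y
      using f_rel[OF \<open>j \<in> {1..n}\<close> that] fg[OF _ that] by (simp add: sum_distrib_left mult.assoc)
  qed fact
  have gk: "nonzero_on_fibre (g k)"
    by (rule primitive_relation_keeps_order[OF g prim g_rel indep])
  obtain u v' p' q where u: "hol u" and v': "hol v'" "\<exists>z\<in>U \<times> V. v' z \<noteq> 0"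
    and quot: "\<And>z. z \<in> U \<times> V \<Longrightarrow> v' z \<noteq> 0 \<Longrightarrow> b i z = u z / v' z"
    and not_dvd: "\<not> eps_power_dvd (U \<times> V) e0 (Suc p') u"
    and "p' < q" and dvd: "eps_power_dvd (U \<times> V) e0 q v'"
    using sing unfolding singularly_perturbed_at_def is_quotient_on_def by blast
  \<comment> \<open>Both \<open>u / v'\<close> and \<open>g i / g k\<close> represent the coefficient \<open>b i\<close>. As \<open>g k\<close> is prime to \<open>e - e0\<close>,
    every power of \<open>e - e0\<close> in \<open>v'\<close> must already occur in \<open>u\<close>.\<close>
  have cross: "g k z * u z = g i z * v' z" if z: "z \<in> U \<times> V" for z
  proof -
    have fi: "hol (f k)" "hol (f i)" "\<exists>z\<in>U \<times> V. f k z \<noteq> 0" using f v \<open>i \<le> k\<close> by (auto simp: f_def)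
    obtain y where y: "y \<in> U \<times> V" "f k y * v' y \<noteq> 0"
      using hol_mult_nonzero[OF fi(1) v'(1) fi(3) v'(2)] by blast
    have diff_f: "f k z * u z - f i z * v' z = 0" if "z \<in> U \<times> V" for z
    proof (rule hol_mult_eq_0[of "\<lambda>z. f k z * v' z" "\<lambda>z. f k z * u z - f i z * v' z", OF _ _ _ y that])
      show "f k x * v' x * (f k x * u x - f i x * v' x) = 0" if "x \<in> U \<times> V" for x
      proof (cases "f k x * v' x = 0")
        case False
        then have "f i x = f k x * b i x" "u x = b i x * v' x"
          using f_b[OF \<open>i \<le> k\<close> that] quot[OF that] by (auto simp: f_def)
        then show ?thesis by simp
      qed simp
    qed (intro hol_intros fi u v')+
    have "(snd y - e0) ^ c * (g k y * u y - g i y * v' y) = 0" if "y \<in> U \<times> V" for y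
    proof -
      have "(snd y - e0) ^ c * (g k y * u y - g i y * v' y) = f k y * u y - f i y * v' y"
        using fg[OF order_refl that] fg[OF \<open>i \<le> k\<close> that] by (simp add: algebra_simps)
      then show ?thesis using diff_f[OF that] by simp
    qed
    then have "g k z * u z - g i z * v' z = 0"
      by (intro eps_cancel[of "\<lambda>z. g k z * u z - g i z * v' z" c, OF _ _ z] hol_intros g u v' \<open>i \<le> k\<close>) auto
    then show ?thesis by simp
  qed
  obtain x where x: "hol x" "\<And>z. z \<in> U \<times> V \<Longrightarrow> v' z = (snd z - e0) ^ q * x z"
    using dvd unfolding eps_power_dvd_def by blast
  obtain m where m: "q = Suc p' + m" using \<open>p' < q\<close> less_iff_Suc_add by auto
  have "eps_power_dvd (U \<times> V) e0 (Suc p') (\<lambda>z. g k z * u z)"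
    unfolding eps_power_dvd_def
    by (rule exI[of _ "\<lambda>z. (snd z - e0) ^ m * (g i z * x z)"])
       (use cross x \<open>i \<le> k\<close> in \<open>auto simp: m power_add mult_ac intro!: hol_intros g\<close>)
  from eps_power_dvd_cancel[OF g[OF order_refl] gk u this] not_dvd show False by blast
qed

end
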